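(* Let $n\ge 1$ be an integer and let $\mathcal{A}\subset\mathbb{Z}_{\ge 0}^{n}$ be a non-empty finite subset. Let $Y_{n,d_{\mathcal{A}}}\subset\mathbb{P}^{|\mathcal{A}|-1}$ be the monomial projection of the Veronese variety associated to $\mathcal{A}$, and let $\mathrm{HF}_{\mathcal{A}}$ be the Hilbert function of its homogeneous coordinate ring. Then: (1) $\mathrm{HF}_{\mathcal{A}}(t)=\varphi_{\mathcal{A}}(t)=|t\mathcal{A}|$ for all integers $t\ge 0$. (2) There exists a polynomial $p_{\mathcal{A}}(t)\in\mathbb{Q}[t]$ of degree $r=\dim(Y_{n,d_{\mathcal{A}}})\le n$, namely the Hilbert polynomial $\mathrm{HP}_{\mathcal{A}}(t)$ of $Y_{n,d_{\mathcal{A}}}$, such that $\mathrm{HF}_{\mathcal{A}}(t)=p_{\mathcal{A}}(t)$ for all sufficiently large $t$.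
   Context: $\mathbb{K}$ is an algebraically closed field of characteristic zero and $R=\mathbb{K}[x_0,\ldots,x_n]$. For $t\ge 1$, $t\mathcal{A}=\{a_1+\cdots+a_t\mid a_i\in\mathcal{A}\}$ (repetitions allowed) and $0\mathcal{A}=\{0\}$; the cardinality function is $\varphi_{\mathcal{A}}(t)=|t\mathcal{A}|$. For a non-empty finite $\mathcal{A}\subset\mathbb{Z}_{\ge0}^n$ and $a=(a_1,\ldots,a_n)\in\mathcal{A}$ put $|a|=a_1+\cdots+a_n$, and let $d_{\mathcal{A}}$ be the least integer $\delta\ge0$ with $|a|\le\delta$ for all $a\in\mathcal{A}$. Put $\Omega_{n,d_{\mathcal{A}}}=\{x_0^{d_{\mathcal{A}}-|a|}x_1^{a_1}\cdots x_n^{a_n}\mid a\in\mathcal{A}\}=\{m_1,\ldots,m_{|\mathcal{A}|}\}\subset R$. The variety $Y_{n,d_{\mathcal{A}}}\subset\mathbb{P}^{|\mathcal{A}|-1}$ is the Zariski closure of the image of the rational map $\mathbb{P}^n\dashrightarrow\mathbb{P}^{|\mathcal{A}|-1}$, $p\mapsto(m_1(p):\cdots:m_{|\mathcal{A}|}(p))$ (it depends on $\mathcal{A}$, not only on $d_{\mathcal{A}}$). Its homogeneous coordinate ring is $A(Y_{n,d_{\mathcal{A}}})=S/I(Y_{n,d_{\mathcal{A}}})$, where $S=\mathbb{K}[w_1,\ldots,w_{|\mathcal{A}|}]$ has the standard grading and $I(Y_{n,d_{\mathcal{A}}})$ is the homogeneous ideal of $Y_{n,d_{\mathcal{A}}}$;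 $\mathrm{HF}_{\mathcal{A}}(t)=\dim_{\mathbb{K}}A(Y_{n,d_{\mathcal{A}}})_t$. *)

theory Defs
  imports
    "HOL-Library.Poly_Mapping"
    "HOL-Library.Extended_Nat"
    "HOL-Computational_Algebra.Polynomial"
    "HOL-Algebra.Embedded_Algebras"
    "HOL-Algebra.QuotRing"
    "HOL-Analysis.Abstract_Topology"
begin

section \<open>Polynomials in variables indexed by a set\<close>

type_synonym 'i monom = "'i \<Rightarrow>\<^sub>0 nat"
type_synonym ('i, 'k) mpoly = "'i monom \<Rightarrow>\<^sub>0 'k"

text \<open>
  Total degree of a monomial. The same function gives \<open>|a|\<close> for an exponent vector \<open>a\<close>.
\<close>
definition tdeg :: "'i monom \<Rightarrow> nat" where
  "tdeg m = (\<Sum>i\<in>Poly_Mapping.keys m. Poly_Mapping.lookup m i)"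

definition monom_eval :: "'i monom \<Rightarrow> ('i \<Rightarrow> 'k::comm_ring_1) \<Rightarrow> 'k" where
  "monom_eval m v = (\<Prod>i\<in>Poly_Mapping.keys m. v i ^ Poly_Mapping.lookup m i)"

definition mpoly_eval :: "('i, 'k::comm_ring_1) mpoly \<Rightarrow> ('i \<Rightarrow> 'k) \<Rightarrow> 'k" where
  "mpoly_eval f v = (\<Sum>m\<in>Poly_Mapping.keys f. Poly_Mapping.lookup f m * monom_eval m v)"

definition mpoly_const :: "'k::comm_ring_1 \<Rightarrow> ('i, 'k) mpoly" where
  "mpoly_const c = Poly_Mapping.single 0 c"

definition mpolys :: "'i set \<Rightarrow> ('i, 'k::comm_ring_1) mpoly set" where
  "mpolys J = {f. \<forall>m\<in>Poly_Mapping.keys f. Poly_Mapping.keys m \<subseteq> J}"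

definition mpoly_ring :: "'i set \<Rightarrow> ('i, 'k::comm_ring_1) mpoly ring" where
  "mpoly_ring J =
    \<lparr>carrier = mpolys J, monoid.mult = (*), one = 1, zero = 0, add = (+)\<rparr>"

definition mpolys_of_degree :: "'i set \<Rightarrow> nat \<Rightarrow> ('i, 'k::comm_ring_1) mpoly set" where
  "mpolys_of_degree J t = {f \<in> mpolys J. \<forall>m\<in>Poly_Mapping.keys f. tdeg m = t}"

definition homogeneous_mpolys :: "'i set \<Rightarrow> ('i, 'k::comm_ring_1) mpoly set" where
  "homogeneous_mpolys J = (\<Union>t. mpolys_of_degree J t)"


section \<open>Projective space and its Zariski topology\<close>

text \<open>
  The projective space with homogeneous coordinates indexed by \<open>J\<close>; for \<open>J = {0..n}\<close> this is
  \<open>n\<close>-dimensional projective space. A vector of the \<open>J\<close>-indexed coordinate space is represented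
  by a function that is 0 outside \<open>J\<close>, and a point is the set of all its coordinate vectors.
\<close>
definition punctured_space :: "'i set \<Rightarrow> ('i \<Rightarrow> 'k::field) set" where
  "punctured_space J = {v. (\<forall>i. i \<notin> J \<longrightarrow> v i = 0) \<and> (\<exists>i\<in>J. v i \<noteq> 0)}"

definition proportional :: "'i set \<Rightarrow> (('i \<Rightarrow> 'k::field) \<times> ('i \<Rightarrow> 'k)) set" where
  "proportional J = {(u, v). u \<in> punctured_space J \<and> v \<in> punctured_space J \<and>
     (\<exists>c. c \<noteq> 0 \<and> v = (\<lambda>i. c * u i))}"

definition proj_space :: "'i set \<Rightarrow> ('i \<Rightarrow> 'k::field) set set" where
  "proj_space J = punctured_space J // proportional J"

definition vanishes_at :: "('i, 'k::field) mpoly \<Rightarrow> ('i \<Rightarrow> 'k) set \<Rightarrow> bool" where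
  "vanishes_at f P \<longleftrightarrow> (\<forall>v\<in>P. mpoly_eval f v = 0)"

definition zero_locus ::
    "'i set \<Rightarrow> ('i, 'k::field) mpoly set \<Rightarrow> ('i \<Rightarrow> 'k) set set" where
  "zero_locus J F = {P \<in> proj_space J. \<forall>f\<in>F. vanishes_at f P}"

definition zariski :: "'i set \<Rightarrow> ('i \<Rightarrow> 'k::field) set topology" where
  "zariski J = topology (\<lambda>U. \<exists>F \<subseteq> homogeneous_mpolys J. U = proj_space J - zero_locus J F)"


section \<open>Dimension of a topological space\<close>

definition irreducible_in :: "'a topology \<Rightarrow> 'a set \<Rightarrow> bool" where
  "irreducible_in X Z \<longleftrightarrow> Z \<subseteq> topspace X \<and> Z \<noteq> {} \<and>
     (\<forall>C D. closedin (subtopology X Z) C \<longrightarrow> closedin (subtopology X Z) D \<longrightarrow>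
        Z = C \<union> D \<longrightarrow> C = Z \<or> D = Z)"

text \<open>
  The supremum of the lengths \<open>m\<close> of chains \<open>Z\<^sub>0 \<subset> \<dots> \<subset> Z\<^sub>m\<close> of irreducible closed subsets.
  (The empty space gets dimension 0 here.)
\<close>
definition top_dim :: "'a topology \<Rightarrow> enat" where
  "top_dim X = Sup {enat m | m. \<exists>Z :: nat \<Rightarrow> 'a set.
     (\<forall>i\<le>m. closedin X (Z i) \<and> irreducible_in X (Z i)) \<and> (\<forall>i<m. Z i \<subset> Z (Suc i))}"

definition variety_dim :: "'i set \<Rightarrow> ('i \<Rightarrow> 'k::field) set set \<Rightarrow> enat" where
  "variety_dim J Y = top_dim (subtopology (zariski J) Y)"


section \<open>Homogeneous coordinate ring, Hilbert function and Hilbert polynomial\<close>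

definition vanishing_ideal ::
    "'i set \<Rightarrow> ('i \<Rightarrow> 'k::field) set set \<Rightarrow> ('i, 'k) mpoly set" where
  "vanishing_ideal J Y =
     Idl\<^bsub>mpoly_ring J\<^esub> {f \<in> homogeneous_mpolys J. \<forall>P\<in>Y. vanishes_at f P}"

definition coord_ring ::
    "'i set \<Rightarrow> ('i \<Rightarrow> 'k::field) set set \<Rightarrow> ('i, 'k) mpoly set ring" where
  "coord_ring J Y = mpoly_ring J Quot vanishing_ideal J Y"

definition residue_class ::
    "'i set \<Rightarrow> ('i \<Rightarrow> 'k::field) set set \<Rightarrow> ('i, 'k) mpoly \<Rightarrow> ('i, 'k) mpoly set" where
  "residue_class J Y f = vanishing_ideal J Y +>\<^bsub>mpoly_ring J\<^esub> f"

text \<open>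
  Dimension over the image of the constants in the coordinate ring of the image of the forms
  of degree \<open>t\<close>.
\<close>
definition hilbert_function :: "'i set \<Rightarrow> ('i \<Rightarrow> 'k::field) set set \<Rightarrow> nat \<Rightarrow> nat" where
  "hilbert_function J Y t =
     ring.dim (coord_ring J Y) (range (\<lambda>c. residue_class J Y (mpoly_const c)))
       (residue_class J Y ` mpolys_of_degree J t)"

definition hilbert_polynomial :: "'i set \<Rightarrow> ('i \<Rightarrow> 'k::field) set set \<Rightarrow> rat poly" where
  "hilbert_polynomial J Y =
     (THE p. \<forall>\<^sub>F t in sequentially. poly p (of_nat t) = of_nat (hilbert_function J Y t))"


section \<open>Sumsets\<close>

definition sumset :: "nat \<Rightarrow> 'a::comm_monoid_add set \<Rightarrow> 'a set" where
  "sumset t A = {sum_list as | as. length as = t \<and> set as \<subseteq> A}"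

definition cardinality_function :: "'a::comm_monoid_add set \<Rightarrow> nat \<Rightarrow> nat" where
  "cardinality_function A t = card (sumset t A)"


section \<open>Monomial projections of Veronese varieties\<close>

text \<open>
  Vectors in \<open>\<nat>\<^sup>n\<close> are the finitely supported functions on \<open>nat\<close> with support in \<open>{1..n}\<close>, so that
  such a vector is also the exponent of a monomial in \<open>x\<^sub>1, \<dots>, x\<^sub>n\<close>.
\<close>
definition nat_vectors :: "nat \<Rightarrow> (nat \<Rightarrow>\<^sub>0 nat) set" where
  "nat_vectors n = {a. Poly_Mapping.keys a \<subseteq> {1..n}}"

definition max_deg :: "(nat \<Rightarrow>\<^sub>0 nat) set \<Rightarrow> nat" where
  "max_deg A = (LEAST \<delta>. \<forall>a\<in>A. tdeg a \<le> \<delta>)"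

definition veronese_form :: "(nat \<Rightarrow>\<^sub>0 nat) set \<Rightarrow> (nat \<Rightarrow>\<^sub>0 nat) \<Rightarrow> (nat, 'k::field) mpoly" where
  "veronese_form A a =
     Poly_Mapping.single (Poly_Mapping.single 0 (max_deg A - tdeg a) + a) 1"

text \<open>
  The coordinates of the target projective space are indexed by \<open>A\<close> itself instead of by an
  enumeration of \<open>A\<close>.
\<close>
definition veronese_coords ::
    "(nat \<Rightarrow>\<^sub>0 nat) set \<Rightarrow> (nat \<Rightarrow> 'k::field) \<Rightarrow> ((nat \<Rightarrow>\<^sub>0 nat) \<Rightarrow> 'k)" where
  "veronese_coords A v = (\<lambda>a. if a \<in> A then mpoly_eval (veronese_form A a) v else 0)"

text \<open>
  The rational map is undefined where all the monomials vanish; such points do not contribute to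
  the image because no point of \<open>proj_space A\<close> contains the zero vector.
\<close>
definition veronese_image ::
    "nat \<Rightarrow> (nat \<Rightarrow>\<^sub>0 nat) set \<Rightarrow> ((nat \<Rightarrow>\<^sub>0 nat) \<Rightarrow> 'k::field) set set" where
  "veronese_image n A =
     {Q \<in> proj_space A. \<exists>P \<in> proj_space {0..n}. \<exists>v\<in>P. veronese_coords A v \<in> Q}"

definition veronese_projection ::
    "nat \<Rightarrow> (nat \<Rightarrow>\<^sub>0 nat) set \<Rightarrow> ((nat \<Rightarrow>\<^sub>0 nat) \<Rightarrow> 'k::field) set set" where
  "veronese_projection n A = zariski A closure_of veronese_image n A"


section \<open>The Zariski topology is a topology\<close>

lemma monom_eval_superset:
  assumes "finite I" "Poly_Mapping.keys m \<subseteq> I"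
  shows "monom_eval m v = (\<Prod>i\<in>I. v i ^ Poly_Mapping.lookup m i)"
  unfolding monom_eval_def
  by (rule prod.mono_neutral_left) (use assms in \<open>auto simp: in_keys_iff\<close>)

lemma monom_eval_add: "monom_eval (m + m') v = monom_eval m v * monom_eval m' v"
proof -
  define I where "I = Poly_Mapping.keys m \<union> Poly_Mapping.keys m'"
  have I: "finite I" "Poly_Mapping.keys m \<subseteq> I" "Poly_Mapping.keys m' \<subseteq> I"
    "Poly_Mapping.keys (m + m') \<subseteq> I"
    using keys_add[of m m'] by (auto simp: I_def)
  show ?thesis
    by (simp add: monom_eval_superset[OF I(1)] I lookup_add power_add prod.distrib)
qed

lemma mpoly_eval_superset:
  assumes "finite M" "Poly_Mapping.keys f \<subseteq> M"
  shows "mpoly_eval f v = (\<Sum>m\<in>M. Poly_Mapping.lookup f m * monom_eval m v)"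
  unfolding mpoly_eval_def
  by (rule sum.mono_neutral_left) (use assms in \<open>auto simp: in_keys_iff\<close>)

lemma mpoly_eval_add: "mpoly_eval (f + g) v = mpoly_eval f v + mpoly_eval g v"
proof -
  define M where "M = Poly_Mapping.keys f \<union> Poly_Mapping.keys g"
  have M: "finite M" "Poly_Mapping.keys f \<subseteq> M" "Poly_Mapping.keys g \<subseteq> M"
    "Poly_Mapping.keys (f + g) \<subseteq> M"
    using keys_add[of f g] by (auto simp: M_def)
  show ?thesis
    by (simp add: mpoly_eval_superset[OF M(1)] M lookup_add distrib_right sum.distrib)
qed

lemma mpoly_eval_zero [simp]: "mpoly_eval 0 v = 0"
  by (simp add: mpoly_eval_def)

lemma mpoly_eval_single [simp]: "mpoly_eval (Poly_Mapping.single m c) v = c * monom_eval m v"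
  by (simp add: mpoly_eval_def)

lemma update_eq_add_single:
  assumes "m \<notin> Poly_Mapping.keys f"
  shows "Poly_Mapping.update m c f = f + Poly_Mapping.single m c"
  using assms
  by (intro poly_mapping_eqI)
    (auto simp: lookup_update lookup_add lookup_single when_def in_keys_iff)

lemma mpoly_eval_mult: "mpoly_eval (f * g) v = mpoly_eval f v * mpoly_eval g v"
proof -
  have single: "mpoly_eval (Poly_Mapping.single m c * h) v =
      c * monom_eval m v * mpoly_eval h v" for m c h
  proof (induction h rule: update_induct)
    case const
    show ?case by simp
  next
    case (update h k b)
    then show ?case
      by (simp add: update_eq_add_single distrib_left mpoly_eval_add mult_single monom_eval_add
          algebra_simps)
  qed
  show ?thesis
  proof (induction f rule: update_induct)
    case const
    show ?case by simp
  next
    case (update h k b)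
    then show ?case
      by (simp add: update_eq_add_single distrib_right mpoly_eval_add single)
  qed
qed

lemma tdeg_superset:
  assumes "finite I" "Poly_Mapping.keys m \<subseteq> I"
  shows "tdeg m = (\<Sum>i\<in>I. Poly_Mapping.lookup m i)"
  unfolding tdeg_def
  by (rule sum.mono_neutral_left) (use assms in \<open>auto simp: in_keys_iff\<close>)

lemma tdeg_add: "tdeg (m + m') = tdeg m + tdeg m'"
proof -
  define I where "I = Poly_Mapping.keys m \<union> Poly_Mapping.keys m'"
  have I: "finite I" "Poly_Mapping.keys m \<subseteq> I" "Poly_Mapping.keys m' \<subseteq> I"
    "Poly_Mapping.keys (m + m') \<subseteq> I"
    using keys_add[of m m'] by (auto simp: I_def)
  show ?thesis
    by (simp add: tdeg_superset[OF I(1)] I lookup_add sum.distrib)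
qed

lemma mpolys_mult:
  assumes "f \<in> mpolys J" "g \<in> mpolys J"
  shows "f * g \<in> mpolys J"
  unfolding mpolys_def
proof (intro CollectI ballI)
  fix m assume "m \<in> Poly_Mapping.keys (f * g)"
  then obtain a b where "m = a + b" "a \<in> Poly_Mapping.keys f" "b \<in> Poly_Mapping.keys g"
    using keys_mult[of f g] by blast
  then show "Poly_Mapping.keys m \<subseteq> J"
    using assms keys_add[of a b] by (fastforce simp: mpolys_def)
qed

lemma homogeneous_mpolys_mult:
  assumes "f \<in> homogeneous_mpolys J" "g \<in> homogeneous_mpolys J"
  shows "f * g \<in> homogeneous_mpolys J"
proof -
  obtain s t where st: "f \<in> mpolys_of_degree J s" "g \<in> mpolys_of_degree J t"
    using assms by (auto simp: homogeneous_mpolys_def)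
  have "tdeg m = s + t" if m: "m \<in> Poly_Mapping.keys (f * g)" for m
  proof -
    obtain a b where "m = a + b" "a \<in> Poly_Mapping.keys f" "b \<in> Poly_Mapping.keys g"
      using m keys_mult[of f g] by blast
    then show ?thesis
      using st by (auto simp: mpolys_of_degree_def tdeg_add)
  qed
  then have "f * g \<in> mpolys_of_degree J (s + t)"
    using st mpolys_mult by (auto simp: mpolys_of_degree_def)
  then show ?thesis
    by (auto simp: homogeneous_mpolys_def)
qed

lemma equiv_proportional:
  "equiv (punctured_space J) (proportional J :: (('i \<Rightarrow> 'k::field) \<times> _) set)"
proof (rule equivI)
  show "proportional J \<subseteq> punctured_space J \<times> punctured_space J"
    by (auto simp: proportional_def)
  show "refl_on (punctured_space J) (proportional J :: (('i \<Rightarrow> 'k) \<times> _) set)"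
    by (auto simp: refl_on_def proportional_def intro!: exI[of _ 1])
  show "sym (proportional J :: (('i \<Rightarrow> 'k) \<times> _) set)"
  proof (rule symI)
    fix u v :: "'i \<Rightarrow> 'k" assume "(u, v) \<in> proportional J"
    then obtain c where "u \<in> punctured_space J" "v \<in> punctured_space J" "c \<noteq> 0"
      "v = (\<lambda>i. c * u i)"
      by (auto simp: proportional_def)
    then show "(v, u) \<in> proportional J"
      by (auto simp: proportional_def intro!: exI[of _ "inverse c"])
  qed
  show "trans (proportional J :: (('i \<Rightarrow> 'k) \<times> _) set)"
  proof (rule transI)
    fix u v w :: "'i \<Rightarrow> 'k" assume "(u, v) \<in> proportional J" "(v, w) \<in> proportional J"
    then obtain c d where "u \<in> punctured_space J" "w \<in> punctured_space J" "c \<noteq> 0" "d \<noteq> 0"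
      "v = (\<lambda>i. c * u i)" "w = (\<lambda>i. d * v i)"
      by (auto simp: proportional_def)
    then show "(u, w) \<in> proportional J"
      by (auto simp: proportional_def intro!: exI[of _ "d * c"])
  qed
qed

lemma mpoly_eval_scale:
  assumes "f \<in> mpolys_of_degree J t"
  shows "mpoly_eval f (\<lambda>i. c * v i) = c ^ t * mpoly_eval f v"
proof -
  have "monom_eval m (\<lambda>i. c * v i) = c ^ tdeg m * monom_eval m v" for m
    by (simp add: monom_eval_def tdeg_def power_mult_distrib prod.distrib power_sum)
  then show ?thesis
    using assms
    by (auto simp: mpoly_eval_def mpolys_of_degree_def sum_distrib_left intro!: sum.cong)
qed

lemma vanishes_at_iff:
  assumes "f \<in> homogeneous_mpolys J" "P \<in> proj_space J" "v \<in> P"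
  shows "vanishes_at f P \<longleftrightarrow> mpoly_eval f v = 0"
proof -
  obtain t where t: "f \<in> mpolys_of_degree J t"
    using assms by (auto simp: homogeneous_mpolys_def)
  have "mpoly_eval f w = 0" if "w \<in> P" "mpoly_eval f v = 0" for w
  proof -
    have "(v, w) \<in> proportional J"
      using assms that equiv_proportional
      by (metis proj_space_def quotient_eq_iff)
    then show ?thesis
      using that mpoly_eval_scale[OF t, of _ v] by (auto simp: proportional_def)
  qed
  then show ?thesis
    using assms(3) by (auto simp: vanishes_at_def)
qed

lemma vanishes_at_mult:
  assumes "f \<in> homogeneous_mpolys J" "g \<in> homogeneous_mpolys J" "P \<in> proj_space J"
  shows "vanishes_at (f * g) P \<longleftrightarrow> vanishes_at f P \<or> vanishes_at g P"
proof -
  obtain v where v: "v \<in> P"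
    using assms(3) equiv_proportional
    by (metis ex_in_conv in_quotient_imp_non_empty proj_space_def)
  then show ?thesis
    using assms homogeneous_mpolys_mult[OF assms(1,2)]
    by (simp add: vanishes_at_iff[OF _ assms(3) v] mpoly_eval_mult)
qed

lemma istopology_zariski:
  "istopology (\<lambda>U :: ('i \<Rightarrow> 'k::field) set set.
     \<exists>F \<subseteq> homogeneous_mpolys J. U = proj_space J - zero_locus J F)"
  (is "istopology ?L")
  unfolding istopology_def
proof (intro conjI allI impI)
  fix S T :: "('i \<Rightarrow> 'k) set set" assume "?L S" "?L T"
  then obtain F G :: "('i, 'k) mpoly set" where FG: "F \<subseteq> homogeneous_mpolys J"
    "G \<subseteq> homogeneous_mpolys J" "S = proj_space J - zero_locus J F"
    "T = proj_space J - zero_locus J G"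
    by blast
  define H where "H = {f * g | f g. f \<in> F \<and> g \<in> G}"
  have "zero_locus J H = zero_locus J F \<union> zero_locus J G"
  proof (intro Set.set_eqI iffI)
    fix P assume P: "P \<in> zero_locus J H"
    have "vanishes_at f P \<or> vanishes_at g P" if "f \<in> F" "g \<in> G" for f g
    proof -
      have "f * g \<in> H"
        using that by (auto simp: H_def)
      then show ?thesis
        using P that FG(1,2) vanishes_at_mult[of f J g P] by (auto simp: zero_locus_def)
    qed
    then show "P \<in> zero_locus J F \<union> zero_locus J G"
      using P by (auto simp: zero_locus_def)
  next
    fix P assume "P \<in> zero_locus J F \<union> zero_locus J G"
    then show "P \<in> zero_locus J H"
      by (auto simp: H_def zero_locus_def vanishes_at_def mpoly_eval_mult)
  qed
  moreover have "H \<subseteq> homogeneous_mpolys J"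
    using FG(1,2) unfolding H_def by (blast intro: homogeneous_mpolys_mult)
  ultimately show "?L (S \<inter> T)"
    using FG by (intro exI[of _ H]) auto
next
  fix \<K> :: "('i \<Rightarrow> 'k) set set set" assume "\<forall>K\<in>\<K>. ?L K"
  then obtain F where F: "\<And>K. K \<in> \<K> \<Longrightarrow> F K \<subseteq> homogeneous_mpolys J"
    "\<And>K. K \<in> \<K> \<Longrightarrow> K = proj_space J - zero_locus J (F K)"
    by metis
  have "\<Union>\<K> = proj_space J - zero_locus J (\<Union>K\<in>\<K>. F K)"
  proof (intro Set.set_eqI iffI)
    fix P assume "P \<in> \<Union>\<K>"
    then obtain K where "K \<in> \<K>" "P \<in> K" by blast
    then show "P \<in> proj_space J - zero_locus J (\<Union>K\<in>\<K>. F K)"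
      using F(2)[of K] unfolding zero_locus_def by blast
  next
    fix P assume P: "P \<in> proj_space J - zero_locus J (\<Union>K\<in>\<K>. F K)"
    then obtain K where K: "K \<in> \<K>" "P \<notin> zero_locus J (F K)"
      by (auto simp: zero_locus_def)
    then have "P \<in> K"
      using F(2)[of K] P by blast
    then show "P \<in> \<Union>\<K>"
      using K by blast
  qed
  then show "?L (\<Union>\<K>)"
    using F(1) by (intro exI[of _ "\<Union>K\<in>\<K>. F K"]) auto
qed

lemma openin_zariski:
  "openin (zariski J) U \<longleftrightarrow>
     (\<exists>F \<subseteq> homogeneous_mpolys J. U = proj_space J - zero_locus J F)"
  by (simp add: zariski_def topology_inverse'[OF istopology_zariski])

lemma topspace_zariski: "topspace (zariski J) = (proj_space J :: ('a \<Rightarrow> 'b::field) set set)"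
proof
  show "topspace (zariski J) \<subseteq> (proj_space J :: ('a \<Rightarrow> 'b) set set)"
    by (auto simp: topspace_def openin_zariski)
  have "zero_locus J {1 :: ('a, 'b) mpoly} = {}"
  proof -
    have "\<not> vanishes_at (1 :: ('a, 'b) mpoly) P" if P: "P \<in> proj_space J" for P
    proof -
      obtain v where "v \<in> P"
        using P equiv_proportional
        by (metis ex_in_conv in_quotient_imp_non_empty proj_space_def)
      then show ?thesis
        by (auto simp: vanishes_at_def monom_eval_def simp flip: single_one)
    qed
    then show ?thesis
      by (auto simp: zero_locus_def)
  qed
  moreover have "(1 :: ('a, 'b) mpoly) \<in> mpolys_of_degree J 0"
    by (auto simp: mpolys_of_degree_def mpolys_def tdeg_def simp flip: single_one)
  ultimately have "openin (zariski J) (proj_space J :: ('a \<Rightarrow> 'b) set set)"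
    unfolding openin_zariski
    by (intro exI[of _ "{1}"]) (auto simp: homogeneous_mpolys_def)
  then show "proj_space J \<subseteq> topspace (zariski J :: ('a \<Rightarrow> 'b) set topology)"
    by (rule openin_subset)
qed

lemma closedin_zariski:
  "closedin (zariski J) C \<longleftrightarrow> (\<exists>F \<subseteq> homogeneous_mpolys J. C = zero_locus J F)"
proof -
  have "zero_locus J F \<subseteq> proj_space J" for F :: "('a, 'b) mpoly set"
    by (auto simp: zero_locus_def)
  then show ?thesis
    unfolding closedin_def topspace_zariski openin_zariski
    by (metis Diff_Diff_Int Diff_subset inf.absorb_iff2)
qed

end

theory Submission
  imports Defs
begin

text \<open>
  Substituting the parametrization into a monomial \<open>w\<^sup>m\<close> of degree \<open>t\<close> in the coordinates indexed
  by \<open>A\<close> gives the monomial in \<open>x\<^sub>0, \<dots>, x\<^sub>n\<close> that belongs to the sum \<open>\<Sum>a. m(a) a\<close>, an element of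
  \<open>tA\<close>. Distinct monomials are linearly independent functions on the torus, as distinct characters
  are (\<open>characters_independent\<close>). Hence a form of degree \<open>t\<close> vanishes on the variety if and only if,
  for each element of \<open>tA\<close>, the coefficients of the monomials over it add up to zero
  (\<open>vanishes_on_projection_iff\<close>), and the Hilbert function counts the elements of \<open>tA\<close>
  (\<open>hilbert_function_eq_card_sumset\<close>).

  That \<open>|tA|\<close> is eventually polynomial is a theorem of Khovanskii. Represent each element of \<open>tA\<close> by
  the least monomial over it, in a total order compatible with multiplication. The representatives
  are closed under divisors, and the number of monomials of degree \<open>t\<close> in such a set is eventually
  polynomial (\<open>eventually_polynomial_degree_count\<close>), because decreasing chains of such sets become
  stationary.

  Three inequalities identify the degree of the polynomial \<open>p\<close> with the dimension of the variety.
  Call \<open>i\<close> a pivot if two elements of some \<open>tA\<close> differ first in the coordinate \<open>i\<close>. The pivot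
  coordinates determine an element of \<open>tA\<close>, hence the degree of \<open>p\<close> is at most the number of pivots,
  which is at most \<open>n\<close> (\<open>card_sumset_le\<close>). Closures of the images of subtori in which the pivot
  coordinates become variable one after the other form a strictly increasing chain of irreducible
  closed sets, hence the number of pivots is at most the dimension (\<open>card_pivots_le_dim\<close>). Finally,
  from a chain of irreducible closed sets of length \<open>m\<close> one obtains, for a fixed \<open>D\<close> and every \<open>q\<close>,
  as many as \<open>(q + m) choose m\<close> forms of degree \<open>q D\<close> that are linearly independent on the variety
  (\<open>chain_independent_forms\<close>). There are at most \<open>|(q D) A|\<close> of them, hence the dimension is at most
  the degree of \<open>p\<close> (\<open>dim_le_degree\<close>).
\<close>

section \<open>Eventually polynomial functions\<close>

definition polynomial_fun :: "(nat \<Rightarrow> rat) \<Rightarrow> bool" where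
  "polynomial_fun h \<longleftrightarrow> (\<exists>p. \<forall>t. h t = poly p (of_nat t))"

lemma polynomial_fun_add:
  "polynomial_fun f \<Longrightarrow> polynomial_fun g \<Longrightarrow> polynomial_fun (\<lambda>t. f t + g t)"
  unfolding polynomial_fun_def by (metis poly_add)

lemma polynomial_fun_mult:
  "polynomial_fun f \<Longrightarrow> polynomial_fun g \<Longrightarrow> polynomial_fun (\<lambda>t. f t * g t)"
  unfolding polynomial_fun_def by (metis poly_mult)

lemma polynomial_fun_const: "polynomial_fun (\<lambda>t. c)"
  unfolding polynomial_fun_def by (rule exI[of _ "[:c:]"]) simp

lemma polynomial_fun_of_nat: "polynomial_fun of_nat"
  unfolding polynomial_fun_def by (rule exI[of _ "[:0, 1:]"]) simp

lemma polynomial_fun_power: "polynomial_fun f \<Longrightarrow> polynomial_fun (\<lambda>t. f t ^ k)"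
  by (induction k) (auto intro: polynomial_fun_const polynomial_fun_mult)

lemma polynomial_fun_sum:
  "(\<And>i. i \<in> I \<Longrightarrow> polynomial_fun (f i)) \<Longrightarrow> polynomial_fun (\<lambda>t. \<Sum>i\<in>I. f i t)"
  by (induction I rule: infinite_finite_induct)
    (auto intro: polynomial_fun_const polynomial_fun_add)

text \<open>
  Summing the binomial expansion \<open>(s + 1)\<^sup>k\<^sup>+\<^sup>1 = \<Sum>j\<le>k+1. (k+1 choose j) s\<^sup>j\<close> over \<open>s \<le> t\<close>
  telescopes, and so expresses the \<open>k\<close>-th power sum through \<open>(t + 1)\<^sup>k\<^sup>+\<^sup>1\<close> and lower power sums.
\<close>
lemma polynomial_fun_power_sum: "polynomial_fun (\<lambda>t. \<Sum>s\<le>t. of_nat s ^ k)"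
proof (induction k rule: less_induct)
  case (less k)
  define S :: "nat \<Rightarrow> nat \<Rightarrow> rat" where "S j t = (\<Sum>s\<le>t. of_nat s ^ j)" for j t
  have binom: "(\<Sum>j\<le>k. of_nat (Suc k choose j) * S j t) = of_nat (Suc t) ^ Suc k" for t
  proof (induction t)
    case 0
    have "(\<Sum>j\<le>k. of_nat (Suc k choose j) * (0::rat) ^ j) = of_nat (Suc k choose 0)"
      by (subst sum.remove[of _ 0]) (auto intro: sum.neutral)
    then show ?case by (simp add: S_def)
  next
    case (Suc t)
    have "(of_nat (Suc t) + 1 :: rat) ^ Suc k =
        (\<Sum>j\<le>Suc k. of_nat (Suc k choose j) * of_nat (Suc t) ^ j)"
      by (subst binomial_ring) simp
    also have "\<dots> = (\<Sum>j\<le>k. of_nat (Suc k choose j) * of_nat (Suc t) ^ j) + of_nat (Suc t) ^ Suc k"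
      by simp
    finally have step: "(of_nat (Suc (Suc t)) :: rat) ^ Suc k =
        (\<Sum>j\<le>k. of_nat (Suc k choose j) * of_nat (Suc t) ^ j) + of_nat (Suc t) ^ Suc k"
      by (simp add: add.commute)
    have "(\<Sum>j\<le>k. of_nat (Suc k choose j) * S j (Suc t)) =
        (\<Sum>j\<le>k. of_nat (Suc k choose j) * S j t) +
        (\<Sum>j\<le>k. of_nat (Suc k choose j) * of_nat (Suc t) ^ j)"
      by (simp add: S_def distrib_left sum.distrib)
    then show ?case
      using Suc step by simp
  qed
  have S_rec: "S k t = (of_nat t + 1) ^ Suc k * inverse (of_nat (Suc k)) +
      (\<Sum>j<k. - inverse (of_nat (Suc k)) * of_nat (Suc k choose j) * S j t)" for t
  proof -
    have "(\<Sum>j<k. of_nat (Suc k choose j) * S j t) + of_nat (Suc k) * S k t =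
        (of_nat t + 1) ^ Suc k"
      using binom[of t] by (simp flip: lessThan_Suc_atMost add: add.commute)
    then have "of_nat (Suc k) * S k t =
        (of_nat t + 1) ^ Suc k - (\<Sum>j<k. of_nat (Suc k choose j) * S j t)"
      by (simp add: algebra_simps)
    then have "S k t = inverse (of_nat (Suc k)) *
        ((of_nat t + 1) ^ Suc k - (\<Sum>j<k. of_nat (Suc k choose j) * S j t))"
      by (simp add: field_simps del: of_nat_Suc)
    then show ?thesis
      by (simp add: right_diff_distrib sum_distrib_left sum_negf mult_ac
          del: of_nat_Suc power_Suc)
  qed
  have lower: "polynomial_fun (S j)" if "j < k" for j
    using less[OF that] by (simp add: S_def[abs_def])
  have "polynomial_fun (\<lambda>t. (of_nat t + 1) ^ Suc k * inverse (of_nat (Suc k)) +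
      (\<Sum>j<k. - inverse (of_nat (Suc k)) * of_nat (Suc k choose j) * S j t))"
    by (intro polynomial_fun_add polynomial_fun_mult polynomial_fun_power polynomial_fun_sum
        polynomial_fun_const polynomial_fun_of_nat lower) simp
  then have "polynomial_fun (S k)"
    by (subst S_rec[abs_def])
  then show ?case by (simp add: S_def[abs_def])
qed

lemma polynomial_fun_partial_sum:
  assumes "polynomial_fun h"
  shows "polynomial_fun (\<lambda>t. \<Sum>s\<le>t. h s)"
proof -
  obtain p where p: "\<And>t. h t = poly p (of_nat t)"
    using assms by (auto simp: polynomial_fun_def)
  have "(\<Sum>s\<le>t. h s) = (\<Sum>k\<le>degree p. Polynomial.coeff p k * (\<Sum>s\<le>t. of_nat s ^ k))" for t
    unfolding p poly_altdef sum_distrib_left by (rule sum.swap)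
  then show ?thesis
    by (simp add: polynomial_fun_sum polynomial_fun_mult polynomial_fun_const
        polynomial_fun_power_sum)
qed

definition eventually_polynomial :: "(nat \<Rightarrow> nat) \<Rightarrow> bool" where
  "eventually_polynomial h \<longleftrightarrow>
     (\<exists>p :: rat poly. \<forall>\<^sub>F t in sequentially. of_nat (h t) = poly p (of_nat t))"

lemma eventually_polynomial_cong:
  assumes "eventually_polynomial g" "\<forall>\<^sub>F t in sequentially. h t = g t"
  shows "eventually_polynomial h"
proof -
  obtain p :: "rat poly" where "\<forall>\<^sub>F t in sequentially. of_nat (g t) = poly p (of_nat t)"
    using assms(1) by (auto simp: eventually_polynomial_def)
  then have "\<forall>\<^sub>F t in sequentially. of_nat (h t) = poly p (of_nat t)"
    using assms(2) by eventually_elim simp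
  then show ?thesis by (auto simp: eventually_polynomial_def)
qed

lemma eventually_polynomial_const: "eventually_polynomial (\<lambda>t. c)"
  unfolding eventually_polynomial_def by (rule exI[of _ "[:of_nat c:]"]) simp

lemma eventually_polynomial_add:
  assumes "eventually_polynomial f" "eventually_polynomial g"
  shows "eventually_polynomial (\<lambda>t. f t + g t)"
proof -
  obtain p q :: "rat poly" where "\<forall>\<^sub>F t in sequentially. of_nat (f t) = poly p (of_nat t)"
    "\<forall>\<^sub>F t in sequentially. of_nat (g t) = poly q (of_nat t)"
    using assms by (auto simp: eventually_polynomial_def)
  then have "\<forall>\<^sub>F t in sequentially. of_nat (f t + g t) = poly (p + q) (of_nat t)"
    by eventually_elim simp
  then show ?thesis unfolding eventually_polynomial_def by blast
qed

lemma eventually_polynomial_sum: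
  "(\<And>i. i \<in> I \<Longrightarrow> eventually_polynomial (f i)) \<Longrightarrow> eventually_polynomial (\<lambda>t. \<Sum>i\<in>I. f i t)"
  by (induction I rule: infinite_finite_induct)
    (auto intro: eventually_polynomial_const eventually_polynomial_add)

lemma eventually_polynomial_shift:
  assumes "eventually_polynomial h"
  shows "eventually_polynomial (\<lambda>t. h (t - j))"
proof -
  obtain p :: "rat poly" where "\<forall>\<^sub>F t in sequentially. of_nat (h t) = poly p (of_nat t)"
    using assms by (auto simp: eventually_polynomial_def)
  then obtain N where N: "\<And>t. t \<ge> N \<Longrightarrow> of_nat (h t) = poly p (of_nat t)"
    by (auto simp: eventually_sequentially)
  have "of_nat (h (t - j)) = poly (pcompose p [:- of_nat j, 1:]) (of_nat t)" if "t \<ge> N + j" for t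
    using that N[of "t - j"] by (simp add: poly_pcompose of_nat_diff)
  then show ?thesis
    unfolding eventually_polynomial_def eventually_sequentially by blast
qed

lemma eventually_polynomial_partial_sum:
  assumes "eventually_polynomial h"
  shows "eventually_polynomial (\<lambda>t. \<Sum>s\<le>t. h s)"
proof -
  obtain p :: "rat poly" where "\<forall>\<^sub>F t in sequentially. of_nat (h t) = poly p (of_nat t)"
    using assms by (auto simp: eventually_polynomial_def)
  then obtain N where N: "\<And>t. t \<ge> N \<Longrightarrow> of_nat (h t) = poly p (of_nat t)"
    by (auto simp: eventually_sequentially)
  have "polynomial_fun (\<lambda>t. \<Sum>s\<le>t. poly p (of_nat s))"
    by (rule polynomial_fun_partial_sum) (auto simp: polynomial_fun_def)
  then obtain q where q: "\<And>t. (\<Sum>s\<le>t. poly p (of_nat s)) = poly q (of_nat t)"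
    by (auto simp: polynomial_fun_def)
  \<comment> \<open>The polynomial that sums \<open>p\<close> is off by the finitely many early terms where \<open>h\<close> and \<open>p\<close> differ.\<close>
  define e :: rat where "e = (\<Sum>s<N. of_nat (h s) - poly p (of_nat s))"
  have "of_nat (\<Sum>s\<le>t. h s) = poly (q + [:e:]) (of_nat t)" if "t \<ge> N" for t
  proof -
    have "(\<Sum>s\<le>t. of_nat (h s) - poly p (of_nat s)) = e"
      unfolding e_def by (rule sum.mono_neutral_right) (use that N in auto)
    then show ?thesis
      by (simp add: sum_subtractf q algebra_simps)
  qed
  then show ?thesis
    unfolding eventually_polynomial_def eventually_sequentially by blast
qed

section \<open>Hilbert functions of downsets of monomials\<close>

definition downset :: "'i set \<Rightarrow> 'i monom set \<Rightarrow> bool" where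
  "downset I D \<longleftrightarrow> (\<forall>m\<in>D. Poly_Mapping.keys m \<subseteq> I) \<and> (\<forall>m u. m + u \<in> D \<longrightarrow> m \<in> D)"

definition slice :: "'i \<Rightarrow> nat \<Rightarrow> 'i set \<Rightarrow> 'i monom set \<Rightarrow> 'i monom set" where
  "slice i j I D = {m. Poly_Mapping.keys m \<subseteq> I \<and> m + Poly_Mapping.single i j \<in> D}"

lemma downset_slice:
  assumes "downset J D"
  shows "downset I (slice i j I D)"
  unfolding downset_def
proof (intro conjI allI impI)
  fix m u assume mu: "m + u \<in> slice i j I D"
  have "Poly_Mapping.keys m \<subseteq> Poly_Mapping.keys (m + u)"
    by (auto simp: in_keys_iff lookup_add)
  moreover have "m + Poly_Mapping.single i j + u \<in> D"
    using mu by (simp add: slice_def ac_simps)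
  ultimately show "m \<in> slice i j I D"
    using assms mu by (auto simp: slice_def downset_def)
qed (auto simp: slice_def)

lemma slice_antimono:
  assumes "downset J D" "j \<le> k"
  shows "slice i k I D \<subseteq> slice i j I D"
proof
  fix m assume m: "m \<in> slice i k I D"
  have "Poly_Mapping.single i k = Poly_Mapping.single i j + Poly_Mapping.single i (k - j)"
    using assms(2) by (simp flip: single_add)
  then have "m + Poly_Mapping.single i j + Poly_Mapping.single i (k - j) \<in> D"
    using m by (simp add: slice_def ac_simps)
  then show "m \<in> slice i j I D"
    using assms(1) m unfolding downset_def slice_def by blast
qed

lemma keys_insert_decompose:
  fixes m :: "'i monom"
  assumes "Poly_Mapping.keys m \<subseteq> insert i I" "i \<notin> I"
  defines "u \<equiv> m - Poly_Mapping.single i (Poly_Mapping.lookup m i)"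
  shows "Poly_Mapping.keys u \<subseteq> I" "m = u + Poly_Mapping.single i (Poly_Mapping.lookup m i)"
proof -
  have "Poly_Mapping.lookup u k = (if k = i then 0 else Poly_Mapping.lookup m k)" for k
    by (simp add: u_def lookup_minus lookup_single when_def)
  then have "Poly_Mapping.keys u \<subseteq> Poly_Mapping.keys m - {i}"
    by (auto simp: in_keys_iff split: if_splits)
  then show "Poly_Mapping.keys u \<subseteq> I"
    using assms by auto
  show "m = u + Poly_Mapping.single i (Poly_Mapping.lookup m i)"
    by (rule poly_mapping_eqI) (simp add: u_def lookup_minus lookup_add lookup_single when_def)
qed

lemma downset_insert_eq:
  assumes "downset (insert i I) D" "downset (insert i I) E" "i \<notin> I"
    "\<And>j. slice i j I D = slice i j I E"
  shows "D = E"
proof -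
  have "m \<in> E" if "m \<in> D" "downset (insert i I) D" "\<And>j. slice i j I D = slice i j I E"
    for D E and m :: "'a monom"
  proof -
    have "Poly_Mapping.keys m \<subseteq> insert i I"
      using that by (auto simp: downset_def)
    from keys_insert_decompose[OF this assms(3)] that(1) show ?thesis
      using that(3) unfolding slice_def by (metis (mono_tags, lifting) mem_Collect_eq)
  qed
  then show ?thesis
    using assms by blast
qed

text \<open>
  This noetherianity of monomials (Dickson's lemma) goes by induction on the variables. The slices
  of the \<open>k\<close>-th downset at height \<open>j\<close> decrease both in \<open>k\<close> and in \<open>j\<close>. The diagonal slices
  stabilise at some \<open>K\<close> by the induction hypothesis, which fixes all slices with \<open>j, k \<ge> K\<close>; the
  finitely many heights \<open>j < K\<close> that remain are treated one at a time.
\<close>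
lemma downset_chain_stable:
  fixes D :: "nat \<Rightarrow> 'i monom set"
  assumes "finite I" "\<And>k. downset I (D k)" "decseq D"
  shows "\<exists>K. \<forall>k\<ge>K. D k = D K"
  using assms
proof (induction I arbitrary: D rule: finite_induct)
  case empty
  have "D k \<subseteq> {0}" for k
    using empty.prems(1)[of k] by (auto simp: downset_def)
  then have *: "D k = {} \<or> D k = {0}" for k
    by blast
  show ?case
  proof (cases "\<exists>K. D K = {}")
    case True
    then obtain K where "D K = {}" by blast
    then show ?thesis
      using empty.prems(2) by (intro exI[of _ K]) (auto simp: decseq_def)
  next
    case False
    then show ?thesis using * by metis
  qed
next
  case (insert i I)
  let ?S = "\<lambda>k j. slice i j I (D k)"
  have mono: "?S k' j' \<subseteq> ?S k j" if "k \<le> k'" "j \<le> j'" for k k' j j'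
  proof -
    have "?S k' j' \<subseteq> ?S k' j"
      by (rule slice_antimono[OF insert.prems(1) that(2)])
    also have "\<dots> \<subseteq> ?S k j"
      using insert.prems(2) that(1) by (auto simp: slice_def decseq_def)
    finally show ?thesis .
  qed
  have "\<exists>K. \<forall>k\<ge>K. ?S k k = ?S K K"
    by (rule insert.IH)
      (use mono in \<open>simp_all add: decseq_def downset_slice[OF insert.prems(1)]\<close>)
  then obtain K where K: "\<And>k. k \<ge> K \<Longrightarrow> ?S k k = ?S K K" by blast
  have "\<exists>L. \<forall>k\<ge>L. ?S k j = ?S L j" for j
    by (rule insert.IH)
      (use mono in \<open>simp_all add: decseq_def downset_slice[OF insert.prems(1)]\<close>)
  then obtain L where L: "\<And>j k. k \<ge> L j \<Longrightarrow> ?S k j = ?S (L j) j" by metis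
  define N where "N = Max (insert K (L ` {..<K}))"
  have N: "K \<le> N" "\<And>j. j < K \<Longrightarrow> L j \<le> N"
    by (auto simp: N_def)
  have "D k = D N" if "k \<ge> N" for k
  proof (rule downset_insert_eq[OF insert.prems(1) insert.prems(1) insert.hyps(2)])
    fix j
    show "?S k j = ?S N j"
    proof (cases "j < K")
      case True
      then have "L j \<le> N" using N by blast
      with that have "L j \<le> k" by simp
      with \<open>L j \<le> N\<close> show ?thesis using L by metis
    next
      case False
      \<comment> \<open>Both slices lie between the diagonal slices at \<open>K\<close> and at \<open>max j k\<close>, which agree.\<close>
      have "?S k' j = ?S K K" if "k' \<ge> K" for k'
      proof
        show "?S k' j \<subseteq> ?S K K" using mono that False by simp
        have "?S K K = ?S (max j k') (max j k')"
          by (rule K[symmetric]) (use that in simp)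
        also have "\<dots> \<subseteq> ?S k' j" by (rule mono) auto
        finally show "?S K K \<subseteq> ?S k' j" .
      qed
      then show ?thesis using N that by simp
    qed
  qed
  then show ?case by blast
qed

lemma finite_monoms_of_degree:
  assumes "finite I"
  shows "finite {m. Poly_Mapping.keys m \<subseteq> I \<and> tdeg m = t}"
proof -
  have "inj_on Poly_Mapping.lookup {m. Poly_Mapping.keys m \<subseteq> I \<and> tdeg m = t}"
    by (simp add: inj_on_def Poly_Mapping.lookup_inject)
  moreover have "Poly_Mapping.lookup ` {m. Poly_Mapping.keys m \<subseteq> I \<and> tdeg m = t} \<subseteq>
      {f. \<forall>i. (i \<in> I \<longrightarrow> f i \<in> {..t}) \<and> (i \<notin> I \<longrightarrow> f i = 0)}"
    using assms by (auto simp: in_keys_iff tdeg_superset[OF assms] intro: member_le_sum)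
  ultimately show ?thesis
    using finite_set_of_finite_funs[OF assms, of "{..t}" 0] finite_imageD finite_subset by blast
qed

lemma tdeg_single: "tdeg (Poly_Mapping.single i j) = j"
  by (simp add: tdeg_def)

definition degree_count :: "'i monom set \<Rightarrow> nat \<Rightarrow> nat" where
  "degree_count D t = card {m \<in> D. tdeg m = t}"

lemma degree_count_insert:
  assumes "finite I" "i \<notin> I" "downset (insert i I) D"
  shows "degree_count D t = (\<Sum>j\<le>t. degree_count (slice i j I D) (t - j))"
proof -
  define X where "X j = {m \<in> slice i j I D. tdeg m = t - j}" for j
  define Y where "Y j = (\<lambda>m. m + Poly_Mapping.single i j) ` X j" for j
  have fin: "finite (X j)" for j
    by (rule finite_subset[OF _ finite_monoms_of_degree[OF assms(1), of "t - j"]])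
      (auto simp: X_def slice_def)
  have Y_lookup: "Poly_Mapping.lookup m i = j" if "m \<in> Y j" for m j
    using that assms(2)
    by (auto simp: Y_def X_def slice_def lookup_add in_keys_iff)
  have "{m \<in> D. tdeg m = t} = (\<Union>j\<in>{..t}. Y j)"
  proof (intro Set.set_eqI iffI)
    fix m assume m: "m \<in> {m \<in> D. tdeg m = t}"
    define j where "j = Poly_Mapping.lookup m i"
    define u where "u = m - Poly_Mapping.single i j"
    have "Poly_Mapping.keys m \<subseteq> insert i I"
      using m assms(3) by (auto simp: downset_def)
    from keys_insert_decompose[OF this assms(2), folded j_def, folded u_def]
    have u: "Poly_Mapping.keys u \<subseteq> I" "m = u + Poly_Mapping.single i j" .
    then have "tdeg u + j = t"
      using m by (auto simp: tdeg_add tdeg_single)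
    then have "u \<in> X j" "j \<le> t"
      using u m by (auto simp: X_def slice_def)
    then show "m \<in> (\<Union>j\<in>{..t}. Y j)"
      using u(2) by (auto simp: Y_def)
  next
    fix m assume "m \<in> (\<Union>j\<in>{..t}. Y j)"
    then show "m \<in> {m \<in> D. tdeg m = t}"
      by (auto simp: Y_def X_def slice_def tdeg_add tdeg_single)
  qed
  moreover have "card (\<Union>j\<in>{..t}. Y j) = (\<Sum>j\<le>t. card (Y j))"
  proof (rule card_UN_disjoint)
    show "\<forall>j\<in>{..t}. finite (Y j)" using fin by (simp add: Y_def)
    show "\<forall>j\<in>{..t}. \<forall>k\<in>{..t}. j \<noteq> k \<longrightarrow> Y j \<inter> Y k = {}" using Y_lookup by blast
  qed simp
  moreover have "card (Y j) = card (X j)" for j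
    unfolding Y_def by (rule card_image) (simp add: inj_on_def)
  ultimately show ?thesis
    by (simp add: degree_count_def X_def)
qed

text \<open>
  Cut the downset into slices along one variable. From some height on all slices are equal, so up
  to finitely many shifted terms the count is a partial sum of the count of the stable slice.
\<close>
lemma eventually_polynomial_degree_count:
  assumes "finite I" "downset I D"
  shows "eventually_polynomial (degree_count D)"
  using assms
proof (induction I arbitrary: D rule: finite_induct)
  case empty
  have "{m \<in> D. tdeg m = t} = {}" if "t > 0" for t
    using empty that by (auto simp: downset_def tdeg_def)
  then have "\<forall>\<^sub>F t in sequentially. degree_count D t = 0"
    unfolding degree_count_def eventually_sequentially
    by (intro exI[of _ 1]) (metis card.empty less_eq_Suc_le One_nat_def)
  with eventually_polynomial_const[of 0] show ?case
    by (rule eventually_polynomial_cong)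
next
  case (insert i I)
  let ?S = "\<lambda>j. slice i j I D"
  have "\<exists>J. \<forall>j\<ge>J. ?S j = ?S J"
    by (rule downset_chain_stable[OF insert.hyps(1)])
      (simp_all add: decseq_def downset_slice[OF insert.prems] slice_antimono[OF insert.prems])
  then obtain J where J: "\<And>j. j \<ge> J \<Longrightarrow> ?S j = ?S J" by blast
  have poly: "eventually_polynomial (degree_count (?S j))" for j
    by (intro insert.IH downset_slice[OF insert.prems])
  have "degree_count D t = (\<Sum>j<J. degree_count (?S j) (t - j)) +
      (\<Sum>s\<le>t - J. degree_count (?S J) s)" if "t \<ge> J" for t
  proof -
    have "{..t} = {..<J} \<union> {J..t}" "{..<J} \<inter> {J..t} = {}"
      using that by auto
    then have "degree_count D t = (\<Sum>j<J. degree_count (?S j) (t - j)) +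
        (\<Sum>j=J..t. degree_count (?S j) (t - j))"
      by (simp add: degree_count_insert[OF insert.hyps insert.prems] sum.union_disjoint)
    also have "(\<Sum>j=J..t. degree_count (?S j) (t - j)) =
        (\<Sum>j=J..t. degree_count (?S J) (t - j))"
      by (intro sum.cong refl) (metis J atLeastAtMost_iff)
    also have "\<dots> = (\<Sum>s\<le>t - J. degree_count (?S J) s)"
      by (rule sum.reindex_bij_witness[of _ "\<lambda>s. t - s" "\<lambda>j. t - j"]) (use that in auto)
    finally show ?thesis .
  qed
  then have "\<forall>\<^sub>F t in sequentially. degree_count D t =
      (\<Sum>j<J. degree_count (?S j) (t - j)) + (\<Sum>s\<le>t - J. degree_count (?S J) s)"
    unfolding eventually_sequentially by blast
  moreover have "eventually_polynomial (\<lambda>t. (\<Sum>j<J. degree_count (?S j) (t - j)) +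
      (\<Sum>s\<le>t - J. degree_count (?S J) s))"
    by (intro eventually_polynomial_add eventually_polynomial_sum eventually_polynomial_shift poly
        eventually_polynomial_shift[OF eventually_polynomial_partial_sum])
  ultimately show ?case
    by (rule eventually_polynomial_cong[rotated])
qed

section \<open>Cardinalities of sumsets are eventually polynomial\<close>

text \<open>
  The monomial \<open>w\<^sup>m\<close> in variables indexed by \<open>A\<close> is a multiset of elements of \<open>A\<close>, and this is its
  sum. The factor \<open>of_nat k\<close> stands for the \<open>k\<close>-fold sum; for exponent vectors, whose product is
  convolution, it is multiplication by the scalar \<open>k\<close>.
\<close>
definition weighted_sum :: "'a::comm_semiring_1 monom \<Rightarrow> 'a" where
  "weighted_sum m = (\<Sum>a\<in>Poly_Mapping.keys m. of_nat (Poly_Mapping.lookup m a) * a)"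

lemma weighted_sum_superset:
  assumes "finite I" "Poly_Mapping.keys m \<subseteq> I"
  shows "weighted_sum m = (\<Sum>a\<in>I. of_nat (Poly_Mapping.lookup m a) * a)"
  unfolding weighted_sum_def
  by (rule sum.mono_neutral_left) (use assms in \<open>auto simp: in_keys_iff\<close>)

lemma weighted_sum_add: "weighted_sum (m + m') = weighted_sum m + weighted_sum m'"
proof -
  define I where "I = Poly_Mapping.keys m \<union> Poly_Mapping.keys m'"
  have I: "finite I" "Poly_Mapping.keys m \<subseteq> I" "Poly_Mapping.keys m' \<subseteq> I"
    "Poly_Mapping.keys (m + m') \<subseteq> I"
    using keys_add[of m m'] by (auto simp: I_def)
  show ?thesis
    by (simp add: weighted_sum_superset[OF I(1)] I lookup_add distrib_right sum.distrib)
qed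

lemma weighted_sum_zero [simp]: "weighted_sum 0 = 0"
  by (simp add: weighted_sum_def)

lemma weighted_sum_single_one [simp]: "weighted_sum (Poly_Mapping.single a (Suc 0)) = a"
  by (simp add: weighted_sum_def)

lemma tdeg_zero [simp]: "tdeg 0 = 0"
  by (simp add: tdeg_def)

lemma tdeg_eq_0_iff: "tdeg m = 0 \<longleftrightarrow> m = 0"
  by (auto simp: tdeg_def in_keys_iff intro!: poly_mapping_eqI)

lemma keys_add_nat: "Poly_Mapping.keys (m + m' :: 'i monom) = Poly_Mapping.keys m \<union> Poly_Mapping.keys m'"
  by (auto simp: in_keys_iff lookup_add)

lemma sumset_0 [simp]: "sumset 0 A = {0}"
  by (auto simp: sumset_def)

lemma sumset_Suc: "sumset (Suc t) A = {a + x | a x. a \<in> A \<and> x \<in> sumset t A}"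
proof (intro Set.set_eqI iffI)
  fix z assume "z \<in> sumset (Suc t) A"
  then obtain as where as: "z = sum_list as" "length as = Suc t" "set as \<subseteq> A"
    by (auto simp: sumset_def)
  then obtain a bs where "as = a # bs" by (cases as) auto
  then show "z \<in> {a + x | a x. a \<in> A \<and> x \<in> sumset t A}"
    using as by (auto simp: sumset_def)
next
  fix z assume "z \<in> {a + x | a x. a \<in> A \<and> x \<in> sumset t A}"
  then obtain a bs where "z = a + sum_list bs" "a \<in> A" "length bs = t" "set bs \<subseteq> A"
    by (auto simp: sumset_def)
  then show "z \<in> sumset (Suc t) A"
    by (auto simp: sumset_def intro!: exI[of _ "a # bs"])
qed

lemma sumset_eq_weighted_sum_image:
  "sumset t A = weighted_sum ` {m. Poly_Mapping.keys m \<subseteq> A \<and> tdeg m = t}"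
proof (induction t)
  case 0
  show ?case by (auto simp: tdeg_eq_0_iff)
next
  case (Suc t)
  show ?case
  proof (intro Set.set_eqI iffI)
    fix z assume "z \<in> sumset (Suc t) A"
    then obtain a m where "z = a + weighted_sum m" "a \<in> A" "Poly_Mapping.keys m \<subseteq> A" "tdeg m = t"
      by (auto simp: sumset_Suc Suc)
    then show "z \<in> weighted_sum ` {m. Poly_Mapping.keys m \<subseteq> A \<and> tdeg m = Suc t}"
      by (intro image_eqI[of _ _ "Poly_Mapping.single a 1 + m"])
        (auto simp: weighted_sum_add tdeg_add tdeg_single keys_add_nat)
  next
    fix z assume "z \<in> weighted_sum ` {m. Poly_Mapping.keys m \<subseteq> A \<and> tdeg m = Suc t}"
    then obtain m where m: "z = weighted_sum m" "Poly_Mapping.keys m \<subseteq> A" "tdeg m = Suc t"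
      by auto
    then obtain a where a: "a \<in> Poly_Mapping.keys m"
      using tdeg_eq_0_iff[of m] by (metis Zero_not_Suc all_not_in_conv keys_eq_empty)
    define u where "u = m - Poly_Mapping.single a 1"
    have mu: "m = Poly_Mapping.single a 1 + u"
      using a by (intro poly_mapping_eqI)
        (auto simp: u_def lookup_add lookup_minus lookup_single when_def in_keys_iff)
    then have "Poly_Mapping.keys u \<subseteq> A" "tdeg u = t" "z = a + weighted_sum u" "a \<in> A"
      using m a by (auto simp: keys_add_nat tdeg_add tdeg_single weighted_sum_add)
    then show "z \<in> sumset (Suc t) A"
      by (auto simp: sumset_Suc Suc)
  qed
qed

lemma finite_sumset:
  assumes "finite A"
  shows "finite (sumset t A)"
proof (induction t)
  case (Suc t)
  have "sumset (Suc t) A = (\<lambda>(a, x). a + x) ` (A \<times> sumset t A)"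
    by (auto simp: sumset_Suc)
  then show ?case using assms Suc by simp
qed simp

text \<open>
  One representative for each element of each sumset: the least monomial, in a total order
  compatible with multiplication, among those of the same degree with the same sum.
\<close>
definition minimal_monoms :: "'a::{comm_semiring_1, linorder} set \<Rightarrow> 'a monom set" where
  "minimal_monoms A = {m. Poly_Mapping.keys m \<subseteq> A \<and>
     (\<forall>m'. Poly_Mapping.keys m' \<subseteq> A \<longrightarrow> tdeg m' = tdeg m \<longrightarrow>
        weighted_sum m' = weighted_sum m \<longrightarrow> m \<le> m')}"

text \<open>
  If \<open>m'\<close> were a smaller competitor of \<open>m\<close>, then \<open>m' + u\<close> would be a smaller competitor of
  \<open>m + u\<close>.
\<close>
lemma downset_minimal_monoms: "downset A (minimal_monoms A)"
  unfolding downset_def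
proof (intro conjI allI impI)
  fix m u assume mu: "m + u \<in> minimal_monoms A"
  then have keys: "Poly_Mapping.keys m \<subseteq> A" "Poly_Mapping.keys u \<subseteq> A"
    by (auto simp: minimal_monoms_def keys_add_nat)
  have "m \<le> m'" if "Poly_Mapping.keys m' \<subseteq> A" "tdeg m' = tdeg m" "weighted_sum m' = weighted_sum m"
    for m'
  proof -
    have "Poly_Mapping.keys (m' + u) \<subseteq> A" "tdeg (m' + u) = tdeg (m + u)"
      "weighted_sum (m' + u) = weighted_sum (m + u)"
      using that keys by (auto simp: keys_add_nat tdeg_add weighted_sum_add)
    then have "m + u \<le> m' + u"
      using mu unfolding minimal_monoms_def by blast
    then show ?thesis
      by (metis add_strict_right_mono leD leI)
  qed
  then show "m \<in> minimal_monoms A"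
    using keys by (auto simp: minimal_monoms_def)
qed (auto simp: minimal_monoms_def)

lemma bij_betw_minimal_monoms:
  assumes "finite A"
  shows "bij_betw weighted_sum {m \<in> minimal_monoms A. tdeg m = t} (sumset t A)"
proof -
  let ?X = "{m \<in> minimal_monoms A. tdeg m = t}"
  have "inj_on weighted_sum ?X"
    by (intro inj_onI) (auto simp: minimal_monoms_def intro: antisym)
  moreover have "weighted_sum ` ?X = sumset t A"
  proof
    show "weighted_sum ` ?X \<subseteq> sumset t A"
      by (auto simp: sumset_eq_weighted_sum_image minimal_monoms_def)
    show "sumset t A \<subseteq> weighted_sum ` ?X"
    proof
      fix z assume "z \<in> sumset t A"
      define F where "F = {m. Poly_Mapping.keys m \<subseteq> A \<and> tdeg m = t \<and> weighted_sum m = z}"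
      have "finite F"
        by (rule finite_subset[OF _ finite_monoms_of_degree[OF assms, of t]]) (auto simp: F_def)
      moreover have "F \<noteq> {}"
        using \<open>z \<in> sumset t A\<close> by (auto simp: F_def sumset_eq_weighted_sum_image)
      ultimately have "Min F \<in> F" "\<forall>m\<in>F. Min F \<le> m"
        by auto
      then show "z \<in> weighted_sum ` ?X"
        by (intro image_eqI[of _ _ "Min F"]) (auto simp: minimal_monoms_def F_def)
    qed
  qed
  ultimately show ?thesis
    by (simp add: bij_betw_def)
qed

lemma card_sumset_eq_degree_count:
  assumes "finite A"
  shows "card (sumset t A) = degree_count (minimal_monoms A) t"
  using bij_betw_same_card[OF bij_betw_minimal_monoms[OF assms]] by (simp add: degree_count_def)

lemma eventually_polynomial_card_sumset:
  fixes A :: "'a::{comm_semiring_1, linorder} set"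
  assumes "finite A"
  shows "eventually_polynomial (\<lambda>t. card (sumset t A))"
  using eventually_polynomial_degree_count[OF assms downset_minimal_monoms]
  by (simp add: card_sumset_eq_degree_count[OF assms])

section \<open>Degree of a polynomial and growth of its values\<close>

lemma abs_sum_powers_le:
  fixes x :: "'a::linordered_field"
  assumes "x \<ge> 1" "I \<subseteq> {..k}"
  shows "\<bar>\<Sum>i\<in>I. c i * x ^ i\<bar> \<le> (\<Sum>i\<in>I. \<bar>c i\<bar>) * x ^ k"
proof -
  have "\<bar>\<Sum>i\<in>I. c i * x ^ i\<bar> \<le> (\<Sum>i\<in>I. \<bar>c i * x ^ i\<bar>)"
    by (rule sum_abs)
  also have "\<dots> \<le> (\<Sum>i\<in>I. \<bar>c i\<bar> * x ^ k)"
    using assms by (intro sum_mono) (auto simp: abs_mult power_abs intro!: mult_left_mono power_increasing)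
  finally show ?thesis by (simp add: sum_distrib_right)
qed

lemma degree_le_if_polynomially_bounded:
  fixes p :: "'a::archimedean_field poly"
  assumes "\<forall>\<^sub>F t in sequentially. \<bar>poly p (of_nat t)\<bar> \<le> C * of_nat t ^ r"
  shows "degree p \<le> r"
proof (rule ccontr)
  assume "\<not> degree p \<le> r"
  then obtain s where s: "degree p = Suc s" "r \<le> s"
    by (cases "degree p") auto
  define l where "l = \<bar>Polynomial.coeff p (Suc s)\<bar>"
  have "l > 0"
    using s(1) by (auto simp: l_def) (metis Zero_not_Suc degree_0 leading_coeff_0_iff)
  define B where "B = (\<Sum>i\<le>s. \<bar>Polynomial.coeff p i\<bar>) + \<bar>C\<bar>"
  obtain N where N: "\<And>t. t \<ge> N \<Longrightarrow> \<bar>poly p (of_nat t)\<bar> \<le> C * of_nat t ^ r"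
    using assms by (auto simp: eventually_sequentially)
  obtain k where k: "B / l < of_nat k"
    using reals_Archimedean2 by blast
  define t where "t = Suc (max N k)"
  define x :: 'a where "x = of_nat t"
  have x: "x \<ge> 1" "x > B / l"
    using less_le_trans[OF k, of "of_nat t"] by (auto simp: x_def t_def simp del: of_nat_Suc)
  have "poly p x = Polynomial.coeff p (Suc s) * x ^ Suc s + (\<Sum>i\<le>s. Polynomial.coeff p i * x ^ i)"
    by (simp add: poly_altdef s(1))
  then have "l * x ^ Suc s \<le> \<bar>poly p x\<bar> + \<bar>\<Sum>i\<le>s. Polynomial.coeff p i * x ^ i\<bar>"
    using x(1) by (simp add: l_def flip: abs_mult[of _ "x ^ Suc s", simplified])
  also have "\<bar>\<Sum>i\<le>s. Polynomial.coeff p i * x ^ i\<bar> \<le> (\<Sum>i\<le>s. \<bar>Polynomial.coeff p i\<bar>) * x ^ s"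
    by (rule abs_sum_powers_le) (use x in auto)
  also have "\<bar>poly p x\<bar> \<le> \<bar>C\<bar> * x ^ s"
  proof -
    have "\<bar>poly p x\<bar> \<le> C * x ^ r"
      using N[of t] by (simp add: t_def x_def)
    also have "\<dots> \<le> \<bar>C\<bar> * x ^ s"
      using x s(2) by (intro mult_mono power_increasing) auto
    finally show ?thesis .
  qed
  finally have "(l * x) * x ^ s \<le> B * x ^ s"
    by (simp add: B_def algebra_simps)
  then have "l * x \<le> B"
    using x(1) by (simp add: mult_le_cancel_right)
  then show False
    using x(2) \<open>l > 0\<close> by (simp add: field_simps)
qed

lemma degree_le_if_card_bounded:
  fixes p :: "rat poly"
  assumes "\<forall>\<^sub>F t in sequentially. of_nat (h t) = poly p (of_nat t)"
    and "\<And>t. h t \<le> (t * M + 1) ^ r"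
  shows "degree p \<le> r"
proof (rule degree_le_if_polynomially_bounded)
  show "\<forall>\<^sub>F t in sequentially. \<bar>poly p (of_nat t)\<bar> \<le> of_nat ((M + 1) ^ r) * of_nat t ^ r"
    using assms(1) eventually_ge_at_top[of 1]
  proof eventually_elim
    case (elim t)
    have "h t \<le> (t * M + 1) ^ r" by (rule assms(2))
    also have "\<dots> \<le> ((M + 1) * t) ^ r"
      using elim(2) by (intro power_mono) auto
    finally have "h t \<le> (M + 1) ^ r * t ^ r" by (simp only: power_mult_distrib)
    then have "of_nat (h t) \<le> (of_nat ((M + 1) ^ r * t ^ r) :: rat)"
      by (simp only: of_nat_le_iff)
    then show ?case using elim(1)[symmetric] by simp
  qed
qed

text \<open>
  The binomial coefficient is at least \<open>((q + m) / m)\<^sup>m\<close>, which grows like \<open>q\<^sup>m\<close>.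
\<close>
lemma degree_ge_if_binomial_le:
  fixes p :: "rat poly"
  assumes "\<forall>\<^sub>F t in sequentially. of_nat (h t) = poly p (of_nat t)"
    and "D \<ge> 1" and "\<And>q. (q + m) choose m \<le> h (q * D)"
  shows "m \<le> degree p"
proof (rule ccontr)
  assume "\<not> m \<le> degree p"
  then obtain s where s: "m = Suc s" "degree p \<le> s"
    by (cases m) auto
  define B where "B = (\<Sum>i\<le>degree p. \<bar>Polynomial.coeff p i\<bar>)"
  define E where "E = B * of_nat D ^ s * of_nat m ^ m"
  obtain N where N: "\<And>t. t \<ge> N \<Longrightarrow> of_nat (h t) = poly p (of_nat t)"
    using assms(1) by (auto simp: eventually_sequentially)
  obtain k where k: "E < of_nat k"
    using reals_Archimedean2 by blast
  define q where "q = Suc (max N k)"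
  have "q * 1 \<le> q * D" using assms(2) by (rule mult_le_mono2)
  then have "N \<le> q * D" "1 \<le> q * D" by (auto simp: q_def)
  have "(of_nat (q + m) / of_nat m) ^ m \<le> (of_nat ((q + m) choose m) :: rat)"
    by (rule binomial_ge_n_over_k_pow_k) simp
  also have "\<dots> \<le> of_nat (h (q * D))"
    using assms(3) by (simp only: of_nat_le_iff)
  also have "\<dots> = poly p (of_nat (q * D))"
    using N \<open>N \<le> q * D\<close> by simp
  also have "\<dots> \<le> B * of_nat (q * D) ^ s"
    unfolding B_def poly_altdef
    by (rule order_trans[OF abs_ge_self abs_sum_powers_le])
      (use s(2) \<open>1 \<le> q * D\<close> of_nat_mono[OF \<open>1 \<le> q * D\<close>, where 'a = rat] in auto)
  finally have "(of_nat (q + m) / of_nat m) ^ m \<le> B * of_nat (q * D) ^ s" .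
  then have "of_nat (q + m) ^ m \<le> B * of_nat (q * D) ^ s * of_nat m ^ m"
    using s(1) by (simp add: power_divide pos_divide_le_eq del: of_nat_add of_nat_Suc)
  moreover have "(of_nat q :: rat) ^ m \<le> of_nat (q + m) ^ m"
    by (intro power_mono) auto
  ultimately have "of_nat q * of_nat q ^ s \<le> E * of_nat q ^ s"
    by (simp add: E_def s(1) power_mult_distrib algebra_simps del: of_nat_Suc)
  moreover have "(of_nat q :: rat) ^ s > 0"
    by (simp add: q_def del: of_nat_Suc)
  ultimately have "of_nat q \<le> E"
    by (simp only: mult_le_cancel_right)
  moreover have "(of_nat k :: rat) \<le> of_nat q"
    unfolding of_nat_le_iff by (simp add: q_def)
  ultimately show False
    using k by simp
qed

section \<open>Pivots bound the growth of sumsets\<close>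

text \<open>
  Pivots are the positions at which differences of elements of equal sumsets can have their first
  nonzero coordinate. As in Gaussian elimination, their number is the rank of the group generated by
  \<open>A - A\<close>.
\<close>
definition pivots :: "(nat \<Rightarrow>\<^sub>0 nat) set \<Rightarrow> nat set" where
  "pivots A = {i. \<exists>t. \<exists>x\<in>sumset t A. \<exists>y\<in>sumset t A.
     (\<forall>j<i. Poly_Mapping.lookup x j = Poly_Mapping.lookup y j) \<and>
     Poly_Mapping.lookup x i \<noteq> Poly_Mapping.lookup y i}"

lemma tdeg_le_max_deg:
  assumes "finite A" "a \<in> A"
  shows "tdeg a \<le> max_deg A"
proof -
  have "\<exists>\<delta>. \<forall>a\<in>A. tdeg a \<le> \<delta>"
    using assms(1) by (intro exI[of _ "Max (tdeg ` A)"]) auto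
  then have "\<forall>a\<in>A. tdeg a \<le> max_deg A"
    unfolding max_deg_def by (rule LeastI_ex)
  then show ?thesis using assms(2) by blast
qed

lemma tdeg_sumset_le:
  assumes "finite A" "x \<in> sumset t A"
  shows "tdeg x \<le> t * max_deg A"
  using assms(2)
proof (induction t arbitrary: x)
  case (Suc t)
  then show ?case
    using tdeg_le_max_deg[OF assms(1)] by (fastforce simp: sumset_Suc tdeg_add intro: add_mono)
qed simp

lemma sumset_nat_vectors:
  assumes "A \<subseteq> nat_vectors n"
  shows "sumset t A \<subseteq> nat_vectors n"
proof (induction t)
  case (Suc t)
  then show ?case
    using assms by (fastforce simp: sumset_Suc nat_vectors_def keys_add_nat)
qed (simp add: nat_vectors_def)

lemma pivots_subset:
  assumes "A \<subseteq> nat_vectors n"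
  shows "pivots A \<subseteq> {1..n}"
proof
  fix i assume "i \<in> pivots A"
  then obtain t x y where xy: "x \<in> sumset t A" "y \<in> sumset t A"
    "Poly_Mapping.lookup x i \<noteq> Poly_Mapping.lookup y i"
    by (auto simp: pivots_def)
  then have "i \<in> Poly_Mapping.keys x \<union> Poly_Mapping.keys y"
    by (auto simp: in_keys_iff)
  then show "i \<in> {1..n}"
    using xy sumset_nat_vectors[OF assms, of t] unfolding nat_vectors_def by blast
qed

lemma lookup_le_tdeg: "Poly_Mapping.lookup m i \<le> tdeg m"
  unfolding tdeg_def by (cases "i \<in> Poly_Mapping.keys m") (auto intro: member_le_sum simp: in_keys_iff)

text \<open>
  Two different elements of a sumset first differ at a pivot, so the pivot coordinates determine an
  element.
\<close>
lemma card_sumset_le: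
  assumes "finite A" "A \<subseteq> nat_vectors n"
  shows "card (sumset t A) \<le> (t * max_deg A + 1) ^ card (pivots A)"
proof -
  define \<rho> where "\<rho> x = restrict (Poly_Mapping.lookup x) (pivots A)" for x :: "nat \<Rightarrow>\<^sub>0 nat"
  have "inj_on \<rho> (sumset t A)"
  proof (rule inj_onI, rule ccontr)
    fix x y assume xy: "x \<in> sumset t A" "y \<in> sumset t A" "\<rho> x = \<rho> y" "x \<noteq> y"
    define i where "i = (LEAST i. Poly_Mapping.lookup x i \<noteq> Poly_Mapping.lookup y i)"
    have ex: "\<exists>i. Poly_Mapping.lookup x i \<noteq> Poly_Mapping.lookup y i"
      using xy(4) by (meson poly_mapping_eqI)
    have i: "Poly_Mapping.lookup x i \<noteq> Poly_Mapping.lookup y i"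
      unfolding i_def using ex by (rule LeastI_ex)
    moreover have "\<forall>j<i. Poly_Mapping.lookup x j = Poly_Mapping.lookup y j"
      unfolding i_def using not_less_Least by blast
    ultimately have "i \<in> pivots A"
      using xy by (auto simp: pivots_def)
    then show False
      using i xy(3) unfolding \<rho>_def by (metis restrict_apply')
  qed
  moreover have "\<rho> ` sumset t A \<subseteq> pivots A \<rightarrow>\<^sub>E {..t * max_deg A}"
    using tdeg_sumset_le[OF assms(1)] lookup_le_tdeg
    by (fastforce simp: \<rho>_def intro: order_trans)
  moreover have fin: "finite (pivots A)"
    using pivots_subset[OF assms(2)] finite_subset by blast
  ultimately have "card (sumset t A) \<le> card (pivots A \<rightarrow>\<^sub>E {..t * max_deg A})"
    by (intro card_inj_on_le) (auto intro!: finite_PiE)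
  then show ?thesis
    using fin by (simp add: card_PiE)
qed

section \<open>Independence of characters\<close>

text \<open>
  Dedekind's argument: given a relation and a \<open>y\<close> at which \<open>\<chi> c\<close> and \<open>\<chi> c0\<close> differ, evaluate
  the relation at \<open>mul x y\<close> and subtract \<open>\<chi> c0 y\<close> times the relation at \<open>x\<close>. This removes \<open>c0\<close>
  from the relation and keeps \<open>c\<close>.
\<close>
lemma characters_independent:
  fixes \<chi> :: "'c \<Rightarrow> 'x \<Rightarrow> 'k::field" and mul :: "'x \<Rightarrow> 'x \<Rightarrow> 'x"
  assumes "finite C"
    and "\<And>x y. x \<in> T \<Longrightarrow> y \<in> T \<Longrightarrow> mul x y \<in> T"
    and "\<And>c x y. c \<in> C \<Longrightarrow> x \<in> T \<Longrightarrow> y \<in> T \<Longrightarrow> \<chi> c (mul x y) = \<chi> c x * \<chi> c y"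
    and "\<And>c c'. c \<in> C \<Longrightarrow> c' \<in> C \<Longrightarrow> c \<noteq> c' \<Longrightarrow> \<exists>x\<in>T. \<chi> c x \<noteq> \<chi> c' x"
    and "\<And>c. c \<in> C \<Longrightarrow> \<exists>x\<in>T. \<chi> c x \<noteq> 0"
    and "\<And>x. x \<in> T \<Longrightarrow> (\<Sum>c\<in>C. \<alpha> c * \<chi> c x) = 0"
    and "c \<in> C"
  shows "\<alpha> c = 0"
  using assms
proof (induction C arbitrary: \<alpha> c rule: finite_induct)
  case (insert c0 C)
  have rest: "\<alpha> c = 0" if c: "c \<in> C" for c
  proof -
    have "c \<noteq> c0" using c insert.hyps by blast
    then obtain y where y: "y \<in> T" "\<chi> c y \<noteq> \<chi> c0 y"
      using insert.prems(3)[of c c0] c by blast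
    have "\<alpha> c * (\<chi> c y - \<chi> c0 y) = 0"
    proof (rule insert.IH[where \<alpha> = "\<lambda>c. \<alpha> c * (\<chi> c y - \<chi> c0 y)"])
      fix x assume x: "x \<in> T"
      have "(\<Sum>c\<in>insert c0 C. \<alpha> c * \<chi> c (mul x y)) - \<chi> c0 y * (\<Sum>c\<in>insert c0 C. \<alpha> c * \<chi> c x) = 0"
        using insert.prems(5) insert.prems(1) x y(1) by simp
      moreover have "(\<Sum>c\<in>insert c0 C. \<alpha> c * \<chi> c (mul x y)) -
          \<chi> c0 y * (\<Sum>c\<in>insert c0 C. \<alpha> c * \<chi> c x) =
          (\<Sum>c\<in>insert c0 C. \<alpha> c * (\<chi> c y - \<chi> c0 y) * \<chi> c x)"
        unfolding sum_distrib_left sum_subtractf[symmetric]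
        by (rule sum.cong) (use insert.prems(2) x y(1) in \<open>auto simp: algebra_simps\<close>)
      ultimately show "(\<Sum>c\<in>C. \<alpha> c * (\<chi> c y - \<chi> c0 y) * \<chi> c x) = 0"
        using insert.hyps by simp
    qed (use insert.prems c in auto)
    then show ?thesis using y(2) by simp
  qed
  show ?case
  proof (cases "c = c0")
    case True
    obtain x where x: "x \<in> T" "\<chi> c0 x \<noteq> 0"
      using insert.prems(4) by blast
    then show ?thesis
      using insert.prems(5)[OF x(1)] insert.hyps rest True by simp
  qed (use rest insert.prems(6) in auto)
qed simp

section \<open>Evaluating forms on the Veronese parametrization\<close>

lemma monom_eval_zero [simp]: "monom_eval 0 v = 1"
  by (simp add: monom_eval_def)

lemma monom_eval_single: "monom_eval (Poly_Mapping.single i k) v = v i ^ k"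
  by (simp add: monom_eval_def)

lemma monom_eval_sum: "monom_eval (\<Sum>a\<in>I. f a) v = (\<Prod>a\<in>I. monom_eval (f a) v)"
  by (induction I rule: infinite_finite_induct) (simp_all add: monom_eval_add)

lemma monom_eval_of_nat_mult: "monom_eval (of_nat k * a :: nat \<Rightarrow>\<^sub>0 nat) v = monom_eval a v ^ k"
  by (induction k) (simp_all add: distrib_right monom_eval_add)

lemma tdeg_sum: "tdeg (\<Sum>a\<in>I. f a) = (\<Sum>a\<in>I. tdeg (f a))"
  by (induction I rule: infinite_finite_induct) (simp_all add: tdeg_add)

lemma tdeg_of_nat_mult: "tdeg (of_nat k * a :: nat \<Rightarrow>\<^sub>0 nat) = k * tdeg a"
  by (induction k) (simp_all add: distrib_right tdeg_add)

lemma monom_eval_weighted_sum: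
  "monom_eval (weighted_sum m :: nat \<Rightarrow>\<^sub>0 nat) v =
     (\<Prod>a\<in>Poly_Mapping.keys m. monom_eval a v ^ Poly_Mapping.lookup m a)"
  by (simp add: weighted_sum_def monom_eval_sum monom_eval_of_nat_mult)

lemma tdeg_weighted_sum:
  "tdeg (weighted_sum m :: nat \<Rightarrow>\<^sub>0 nat) =
     (\<Sum>a\<in>Poly_Mapping.keys m. Poly_Mapping.lookup m a * tdeg a)"
  by (simp add: weighted_sum_def tdeg_sum tdeg_of_nat_mult)

lemma veronese_coords_eq:
  assumes "a \<in> A"
  shows "veronese_coords A v a = v 0 ^ (max_deg A - tdeg a) * monom_eval a v"
  using assms by (simp add: veronese_coords_def veronese_form_def monom_eval_add monom_eval_single)

text \<open>
  The Veronese parametrization turns a monomial in the coordinates into a monomial in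
  \<open>x\<^sub>0, \<dots>, x\<^sub>n\<close>. Since it has degree \<open>t * max_deg A\<close>, the exponent of \<open>x\<^sub>0\<close> is determined by the
  weighted sum.
\<close>
lemma monom_eval_veronese_coords:
  assumes "finite A" "Poly_Mapping.keys m \<subseteq> A" "tdeg m = t"
  shows "monom_eval m (veronese_coords A v) =
    v 0 ^ (t * max_deg A - tdeg (weighted_sum m)) * monom_eval (weighted_sum m) v"
proof -
  let ?e = "\<Sum>a\<in>Poly_Mapping.keys m. (max_deg A - tdeg a) * Poly_Mapping.lookup m a"
  have "?e + tdeg (weighted_sum m) =
      (\<Sum>a\<in>Poly_Mapping.keys m. max_deg A * Poly_Mapping.lookup m a)"
    unfolding tdeg_weighted_sum sum.distrib[symmetric]
  proof (rule sum.cong)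
    fix a assume "a \<in> Poly_Mapping.keys m"
    then have "tdeg a \<le> max_deg A"
      using assms tdeg_le_max_deg by blast
    then show "(max_deg A - tdeg a) * Poly_Mapping.lookup m a + Poly_Mapping.lookup m a * tdeg a =
        max_deg A * Poly_Mapping.lookup m a"
      by (metis add_mult_distrib le_add_diff_inverse2 mult.commute)
  qed simp
  also have "\<dots> = t * max_deg A"
    using assms(3) by (simp add: tdeg_def mult.commute flip: sum_distrib_left)
  finally have e: "?e = t * max_deg A - tdeg (weighted_sum m)" by simp
  have "monom_eval m (veronese_coords A v) =
      (\<Prod>a\<in>Poly_Mapping.keys m.
         (v 0 ^ (max_deg A - tdeg a) * monom_eval a v) ^ Poly_Mapping.lookup m a)"
    unfolding monom_eval_def[of m]
    using assms(2) by (intro prod.cong) (auto simp: veronese_coords_eq subset_iff)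
  also have "\<dots> = v 0 ^ ?e * monom_eval (weighted_sum m) v"
    by (simp add: power_mult_distrib prod.distrib monom_eval_weighted_sum power_sum
        flip: power_mult)
  finally show ?thesis by (simp only: e)
qed

text \<open>
  The coefficient of \<open>x\<^sup>c\<close> in the form that arises from \<open>f\<close> by substituting the Veronese
  parametrization and setting \<open>x\<^sub>0 = 1\<close>.
\<close>
definition fibre_coeff :: "('a::comm_semiring_1, 'k::comm_ring_1) mpoly \<Rightarrow> 'a \<Rightarrow> 'k" where
  "fibre_coeff f c = (\<Sum>m | m \<in> Poly_Mapping.keys f \<and> weighted_sum m = c. Poly_Mapping.lookup f m)"

lemma mpoly_eval_veronese_coords:
  assumes "finite A" "f \<in> mpolys_of_degree A t"
  shows "mpoly_eval f (veronese_coords A v) =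
    (\<Sum>c\<in>weighted_sum ` Poly_Mapping.keys f.
       fibre_coeff f c * (v 0 ^ (t * max_deg A - tdeg c) * monom_eval c v))"
proof -
  have "mpoly_eval f (veronese_coords A v) = (\<Sum>m\<in>Poly_Mapping.keys f. Poly_Mapping.lookup f m *
      (v 0 ^ (t * max_deg A - tdeg (weighted_sum m)) * monom_eval (weighted_sum m) v))"
    unfolding mpoly_eval_def
    by (rule sum.cong)
      (use assms in \<open>auto simp: mpolys_of_degree_def mpolys_def monom_eval_veronese_coords\<close>)
  also have "\<dots> = (\<Sum>c\<in>weighted_sum ` Poly_Mapping.keys f.
      \<Sum>m | m \<in> Poly_Mapping.keys f \<and> weighted_sum m = c. Poly_Mapping.lookup f m *
        (v 0 ^ (t * max_deg A - tdeg (weighted_sum m)) * monom_eval (weighted_sum m) v))"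
    by (rule sum.image_gen) simp
  also have "\<dots> = (\<Sum>c\<in>weighted_sum ` Poly_Mapping.keys f.
       fibre_coeff f c * (v 0 ^ (t * max_deg A - tdeg c) * monom_eval c v))"
    by (rule sum.cong) (auto simp: fibre_coeff_def sum_distrib_right)
  finally show ?thesis .
qed

section \<open>The torus and its monomial functions\<close>

text \<open>
  Points of projective space with nonzero coordinates, normalised by \<open>x\<^sub>0 = 1\<close>. Only the coordinates
  in \<open>S\<close> vary; these subtori parametrize the chain of subvarieties constructed below.
\<close>
definition torus :: "nat \<Rightarrow> nat set \<Rightarrow> (nat \<Rightarrow> 'k::field) set" where
  "torus n S = {v. v 0 = 1 \<and> (\<forall>i. i \<notin> {0..n} \<longrightarrow> v i = 0) \<and> (\<forall>i\<in>{1..n}. v i \<noteq> 0) \<and>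
     (\<forall>i\<in>{1..n} - S. v i = 1)}"

definition one_except :: "nat \<Rightarrow> nat \<Rightarrow> 'k::field \<Rightarrow> nat \<Rightarrow> 'k" where
  "one_except n i c = (\<lambda>j. if j \<le> n then if j = i then c else 1 else 0)"

lemma one_except_in_torus:
  assumes "i \<in> S" "i \<in> {1..n}" "c \<noteq> 0"
  shows "one_except n i c \<in> torus n S"
  using assms by (auto simp: torus_def one_except_def)

lemma one_in_torus: "one_except n 0 1 \<in> torus n S"
  by (auto simp: torus_def one_except_def)

lemma monom_eval_one_except:
  assumes "a \<in> nat_vectors n"
  shows "monom_eval a (one_except n i c) = c ^ Poly_Mapping.lookup a i"
proof -
  have out: "Poly_Mapping.lookup a j = 0" if "\<not> j \<le> n" for j
  proof -
    have "j \<notin> Poly_Mapping.keys a" using assms that by (auto simp: nat_vectors_def)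
    then show ?thesis by (simp add: in_keys_iff)
  qed
  have "monom_eval a (one_except n i c) =
      (\<Prod>j\<in>insert i (Poly_Mapping.keys a). one_except n i c j ^ Poly_Mapping.lookup a j)"
    by (rule monom_eval_superset) auto
  also have "\<dots> = (\<Prod>j\<in>{i}. c ^ Poly_Mapping.lookup a j)"
    using assms
    by (intro prod.mono_neutral_cong_right)
      (auto simp: one_except_def out in_keys_iff)
  finally show ?thesis by simp
qed

lemma monom_eval_nonzero:
  assumes "a \<in> nat_vectors n" "v \<in> torus n S"
  shows "monom_eval a v \<noteq> 0"
  using assms by (auto simp: monom_eval_def torus_def nat_vectors_def subset_iff)

lemma monom_eval_times: "monom_eval a (\<lambda>i. v i * w i) = monom_eval a v * monom_eval a w"
  by (simp add: monom_eval_def power_mult_distrib prod.distrib)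

lemma power_two_eq_iff: "(2 :: 'a::ring_char_0) ^ i = 2 ^ j \<longleftrightarrow> i = j"
proof
  assume "(2 :: 'a) ^ i = 2 ^ j"
  then have "(of_nat (2 ^ i) :: 'a) = of_nat (2 ^ j)" by simp
  then show "i = j" by (simp only: of_nat_eq_iff) simp
qed simp

text \<open>
  Monomials are characters of the torus. Two that differ in the exponent of \<open>x\<^sub>i\<close> differ at the
  point with \<open>x\<^sub>i = 2\<close> and all other coordinates 1, because the characteristic is zero.
\<close>
lemma monom_functions_independent:
  fixes \<alpha> :: "(nat \<Rightarrow>\<^sub>0 nat) \<Rightarrow> 'k::field_char_0"
  assumes "finite C" "C \<subseteq> nat_vectors n"
    and "\<And>v. v \<in> torus n {1..n} \<Longrightarrow> (\<Sum>c\<in>C. \<alpha> c * monom_eval c v) = 0"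
    and "c \<in> C"
  shows "\<alpha> c = 0"
proof (rule characters_independent[where T = "torus n {1..n}" and \<chi> = monom_eval
      and mul = "\<lambda>v w i. v i * w i" and C = C])
  fix c c' assume c: "c \<in> C" "c' \<in> C" "c \<noteq> c'"
  then obtain i where i: "Poly_Mapping.lookup c i \<noteq> Poly_Mapping.lookup c' i"
    by (meson poly_mapping_eqI)
  then have "i \<in> Poly_Mapping.keys c \<union> Poly_Mapping.keys c'"
    by (auto simp: in_keys_iff)
  then have "i \<in> {1..n}"
    using c assms(2) unfolding nat_vectors_def by blast
  have "(2::'k) ^ Poly_Mapping.lookup c i \<noteq> 2 ^ Poly_Mapping.lookup c' i"
    using i by (simp add: power_two_eq_iff)
  then show "\<exists>v\<in>torus n {1..n}. monom_eval c v \<noteq> (monom_eval c' v :: 'k)"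
    using c assms(2) one_except_in_torus[of i "{1..n}" n "2::'k"] \<open>i \<in> {1..n}\<close>
    by (intro bexI[of _ "one_except n i 2"]) (auto simp: monom_eval_one_except subset_iff)
next
  fix c assume "c \<in> C"
  then show "\<exists>v\<in>torus n {1..n}. monom_eval c v \<noteq> (0 :: 'k)"
    using assms(2) one_in_torus monom_eval_nonzero by blast
qed (use assms in \<open>auto simp: monom_eval_times torus_def\<close>)

lemma fibre_coeff_eq_0:
  fixes f :: "(nat \<Rightarrow>\<^sub>0 nat, 'k::field_char_0) mpoly"
  assumes "finite A" "A \<subseteq> nat_vectors n" "f \<in> mpolys_of_degree A t"
    and "\<And>v. v \<in> torus n {1..n} \<Longrightarrow> mpoly_eval f (veronese_coords A v) = 0"
  shows "fibre_coeff f c = 0"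
proof (cases "c \<in> weighted_sum ` Poly_Mapping.keys f")
  case True
  have "weighted_sum ` Poly_Mapping.keys f \<subseteq> sumset t A"
    using assms(3) by (auto simp: sumset_eq_weighted_sum_image mpolys_of_degree_def mpolys_def)
  then have nv: "weighted_sum ` Poly_Mapping.keys f \<subseteq> nat_vectors n"
    using sumset_nat_vectors[OF assms(2)] by blast
  have "(\<Sum>c\<in>weighted_sum ` Poly_Mapping.keys f. fibre_coeff f c * monom_eval c v) = 0"
    if v: "v \<in> torus n {1..n}" for v
  proof -
    have "v 0 = 1" using v by (simp add: torus_def)
    with assms(4)[OF v] show ?thesis
      by (simp add: mpoly_eval_veronese_coords[OF assms(1,3)])
  qed
  from monom_functions_independent[OF _ nv this True] show ?thesis by simp
next
  case False
  then have "{m. m \<in> Poly_Mapping.keys f \<and> weighted_sum m = c} = {}" by auto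
  then show ?thesis by (simp only: fibre_coeff_def sum.empty)
qed

section \<open>Forms that vanish on the projected Veronese variety\<close>

definition veronese_point :: "(nat \<Rightarrow>\<^sub>0 nat) set \<Rightarrow> (nat \<Rightarrow> 'k::field) \<Rightarrow> ((nat \<Rightarrow>\<^sub>0 nat) \<Rightarrow> 'k) set" where
  "veronese_point A v = proportional A `` {veronese_coords A v}"

lemma veronese_point:
  assumes "A \<subseteq> nat_vectors n" "A \<noteq> {}" "v \<in> torus n S"
  shows "veronese_point A v \<in> proj_space A" "veronese_coords A v \<in> veronese_point A v"
proof -
  obtain a where a: "a \<in> A" using assms(2) by blast
  have "v 0 = 1" using assms(3) by (simp add: torus_def)
  then have "veronese_coords A v a \<noteq> 0"
    using a assms monom_eval_nonzero[of a n v S] by (auto simp: veronese_coords_eq)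
  then have p: "veronese_coords A v \<in> punctured_space A"
    using a by (auto simp: punctured_space_def veronese_coords_def)
  then show "veronese_point A v \<in> proj_space A"
    unfolding veronese_point_def proj_space_def by (rule quotientI)
  show "veronese_coords A v \<in> veronese_point A v"
    unfolding veronese_point_def by (rule equiv_class_self[OF equiv_proportional p])
qed

lemma vanishes_at_veronese_point:
  assumes "A \<subseteq> nat_vectors n" "A \<noteq> {}" "v \<in> torus n S" "f \<in> homogeneous_mpolys A"
  shows "vanishes_at f (veronese_point A v) \<longleftrightarrow> mpoly_eval f (veronese_coords A v) = 0"
  using vanishes_at_iff[OF assms(4) veronese_point[OF assms(1-3)]] .

lemma veronese_point_in_image:
  assumes "A \<subseteq> nat_vectors n" "A \<noteq> {}" "v \<in> torus n S"
  shows "veronese_point A v \<in> veronese_image n A"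
proof -
  have "v \<in> punctured_space {0..n}"
    using assms(3) by (auto simp: punctured_space_def torus_def intro!: bexI[of _ 0])
  then have "proportional {0..n} `` {v} \<in> proj_space {0..n}" "v \<in> proportional {0..n} `` {v}"
    unfolding proj_space_def by (rule quotientI, rule equiv_class_self[OF equiv_proportional])
  then show ?thesis
    using veronese_point[OF assms] unfolding veronese_image_def by blast
qed

text \<open>
  The torus alone forces the coefficients to vanish. Conversely, their vanishing makes the form zero
  also at the points of the image outside of the torus.
\<close>
lemma vanishes_on_image_iff:
  fixes f :: "(nat \<Rightarrow>\<^sub>0 nat, 'k::field_char_0) mpoly"
  assumes "finite A" "A \<subseteq> nat_vectors n" "A \<noteq> {}" "f \<in> mpolys_of_degree A t"
  shows "(\<forall>P\<in>veronese_image n A. vanishes_at f P) \<longleftrightarrow> (\<forall>c. fibre_coeff f c = 0)"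
proof
  have f: "f \<in> homogeneous_mpolys A"
    using assms(4) by (auto simp: homogeneous_mpolys_def)
  show "\<forall>c. fibre_coeff f c = 0" if "\<forall>P\<in>veronese_image n A. vanishes_at f P"
    using that fibre_coeff_eq_0[OF assms(1,2,4)] veronese_point_in_image[OF assms(2,3)]
      vanishes_at_veronese_point[OF assms(2,3) _ f] by blast
  show "\<forall>P\<in>veronese_image n A. vanishes_at f P" if "\<forall>c. fibre_coeff f c = 0"
    using that vanishes_at_iff[OF f]
    by (auto simp: veronese_image_def mpoly_eval_veronese_coords[OF assms(1,4)])
qed

lemma closedin_zero_locus:
  "f \<in> homogeneous_mpolys J \<Longrightarrow> closedin (zariski J) (zero_locus J {f})"
  unfolding closedin_zariski by blast

lemma vanishes_on_closure_iff:
  assumes "f \<in> homogeneous_mpolys J" "W \<subseteq> proj_space J"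
  shows "(\<forall>P\<in>zariski J closure_of W. vanishes_at f P) \<longleftrightarrow> (\<forall>P\<in>W. vanishes_at f P)"
proof
  assume "\<forall>P\<in>W. vanishes_at f P"
  then have "W \<subseteq> zero_locus J {f}"
    using assms(2) by (auto simp: zero_locus_def)
  then have "zariski J closure_of W \<subseteq> zero_locus J {f}"
    by (rule closure_of_minimal[OF _ closedin_zero_locus[OF assms(1)]])
  then show "\<forall>P\<in>zariski J closure_of W. vanishes_at f P"
    by (auto simp: zero_locus_def)
next
  have "W \<subseteq> zariski J closure_of W"
    by (rule closure_of_subset) (simp add: topspace_zariski assms(2))
  then show "\<forall>P\<in>W. vanishes_at f P" if "\<forall>P\<in>zariski J closure_of W. vanishes_at f P"
    using that by blast
qed

section \<open>Irreducible closed sets\<close>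

lemma irreducible_in_subtopology:
  assumes "Z \<subseteq> Y"
  shows "irreducible_in (subtopology X Y) Z \<longleftrightarrow> irreducible_in X Z"
  using assms by (auto simp: irreducible_in_def subtopology_subtopology Int_absorb1)

text \<open>
  Two proper closed subsets of the closure lie in the zero loci of two forms that do not vanish
  identically on \<open>W\<close>. By assumption these have a common nonzero on \<open>W\<close>, which neither subset
  contains.
\<close>
lemma irreducible_in_closure:
  fixes W :: "('i \<Rightarrow> 'k::field) set set"
  assumes W: "W \<subseteq> proj_space J" "W \<noteq> {}"
    and prime: "\<And>f g. f \<in> homogeneous_mpolys J \<Longrightarrow> g \<in> homogeneous_mpolys J \<Longrightarrow>
      \<exists>P\<in>W. \<not> vanishes_at f P \<Longrightarrow> \<exists>P\<in>W. \<not> vanishes_at g P \<Longrightarrow>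
      \<exists>P\<in>W. \<not> vanishes_at f P \<and> \<not> vanishes_at g P"
  shows "irreducible_in (zariski J) (zariski J closure_of W)"
proof -
  let ?Z = "zariski J closure_of W"
  have WZ: "W \<subseteq> ?Z"
    by (rule closure_of_subset) (simp add: topspace_zariski W)
  have Z: "?Z \<subseteq> proj_space J"
    using closure_of_subset_topspace[of "zariski J" W] by (simp add: topspace_zariski)
  show ?thesis
    unfolding irreducible_in_def
  proof (intro conjI allI impI)
    show "?Z \<subseteq> topspace (zariski J)" by (rule closure_of_subset_topspace)
    show "?Z \<noteq> {}" using WZ W(2) by blast
    fix C D assume "closedin (subtopology (zariski J) ?Z) C" "closedin (subtopology (zariski J) ?Z) D"
      and CD: "?Z = C \<union> D"
    then obtain F G where F: "F \<subseteq> homogeneous_mpolys J" "C = zero_locus J F \<inter> ?Z"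
      and G: "G \<subseteq> homogeneous_mpolys J" "D = zero_locus J G \<inter> ?Z"
      unfolding closedin_subtopology closedin_zariski by blast
    have ex: "\<exists>h\<in>H. \<exists>P\<in>W. \<not> vanishes_at h P"
      if H: "H \<subseteq> homogeneous_mpolys J" and neq: "zero_locus J H \<inter> ?Z \<noteq> ?Z" for H
    proof -
      obtain P h where "P \<in> ?Z" "h \<in> H" "\<not> vanishes_at h P"
        using neq Z by (auto simp: zero_locus_def)
      then show ?thesis
        using vanishes_on_closure_iff[of h J W] H W(1) by blast
    qed
    show "C = ?Z \<or> D = ?Z"
    proof (rule ccontr)
      assume "\<not> (C = ?Z \<or> D = ?Z)"
      then obtain f g where f: "f \<in> F" "\<exists>P\<in>W. \<not> vanishes_at f P"
        and g: "g \<in> G" "\<exists>P\<in>W. \<not> vanishes_at g P"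
        using ex[OF F(1)] ex[OF G(1)] F(2) G(2) by blast
      then obtain P where P: "P \<in> W" "\<not> vanishes_at f P" "\<not> vanishes_at g P"
        using prime[of f g] F(1) G(1) by blast
      then have "P \<notin> C" "P \<notin> D"
        using f(1) g(1) F(2) G(2) by (auto simp: zero_locus_def)
      then show False
        using P(1) WZ CD by blast
    qed
  qed
qed

lemma irreducible_vanishes_mult:
  assumes Z: "irreducible_in (zariski J) Z"
    and fg: "f \<in> homogeneous_mpolys J" "g \<in> homogeneous_mpolys J"
    and van: "\<forall>P\<in>Z. vanishes_at (f * g) P"
  shows "(\<forall>P\<in>Z. vanishes_at f P) \<or> (\<forall>P\<in>Z. vanishes_at g P)"
proof -
  have ZJ: "Z \<subseteq> proj_space J"
    using Z by (simp add: irreducible_in_def topspace_zariski)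
  have "closedin (subtopology (zariski J) Z) (zero_locus J {h} \<inter> Z)"
    if "h \<in> homogeneous_mpolys J" for h
    using closedin_zero_locus[OF that] by (auto simp: closedin_subtopology)
  moreover have "Z = (zero_locus J {f} \<inter> Z) \<union> (zero_locus J {g} \<inter> Z)"
    using van vanishes_at_mult[OF fg] ZJ by (auto simp: zero_locus_def)
  ultimately have "zero_locus J {f} \<inter> Z = Z \<or> zero_locus J {g} \<inter> Z = Z"
    using Z fg unfolding irreducible_in_def by metis
  then show ?thesis
    by (auto simp: zero_locus_def)
qed

section \<open>Irreducibility of torus closures\<close>

definition univariate :: "('k::comm_ring_1 \<Rightarrow> 'k) \<Rightarrow> bool" where
  "univariate F \<longleftrightarrow> (\<exists>p. F = poly p)"

lemma univariate_add: "univariate F \<Longrightarrow> univariate G \<Longrightarrow> univariate (\<lambda>s. F s + G s)"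
  unfolding univariate_def
  by (elim exE, rename_tac p q, rule_tac x = "p + q" in exI) (simp add: fun_eq_iff)

lemma univariate_mult: "univariate F \<Longrightarrow> univariate G \<Longrightarrow> univariate (\<lambda>s. F s * G s)"
  unfolding univariate_def
  by (elim exE, rename_tac p q, rule_tac x = "p * q" in exI) (simp add: fun_eq_iff)

lemma univariate_const: "univariate (\<lambda>s. c)"
  unfolding univariate_def by (rule exI[of _ "[:c:]"]) auto

lemma univariate_linear: "univariate (\<lambda>s. (1 - s) * a + s * b)"
  unfolding univariate_def by (rule exI[of _ "[:a, b - a:]"]) (auto simp: algebra_simps)

lemma univariate_power: "univariate F \<Longrightarrow> univariate (\<lambda>s. F s ^ k)"
  by (induction k) (auto intro: univariate_const univariate_mult)

lemma univariate_sum: "(\<And>i. i \<in> I \<Longrightarrow> univariate (F i)) \<Longrightarrow> univariate (\<lambda>s. \<Sum>i\<in>I. F i s)"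
  by (induction I rule: infinite_finite_induct) (auto intro: univariate_const univariate_add)

lemma univariate_prod: "(\<And>i. i \<in> I \<Longrightarrow> univariate (F i)) \<Longrightarrow> univariate (\<lambda>s. \<Prod>i\<in>I. F i s)"
  by (induction I rule: infinite_finite_induct) (auto intro: univariate_const univariate_mult)

lemma univariate_monom_eval:
  "(\<And>i. univariate (\<lambda>s. u s i)) \<Longrightarrow> univariate (\<lambda>s. monom_eval m (u s))"
  unfolding monom_eval_def by (intro univariate_prod univariate_power)

lemma univariate_mpoly_eval:
  "(\<And>i. univariate (\<lambda>s. u s i)) \<Longrightarrow> univariate (\<lambda>s. mpoly_eval f (u s))"
  unfolding mpoly_eval_def
  by (intro univariate_sum univariate_mult univariate_const univariate_monom_eval)

lemma finite_zeros_univariate: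
  fixes F :: "'k::idom \<Rightarrow> 'k"
  assumes "univariate F" "F s \<noteq> 0"
  shows "finite {s. F s = 0}"
proof -
  obtain p where p: "F = poly p" using assms(1) by (auto simp: univariate_def)
  then have "p \<noteq> 0" using assms(2) by auto
  then show ?thesis unfolding p by (rule poly_roots_finite)
qed

text \<open>
  Join a nonzero of \<open>f\<close> to a nonzero of \<open>g\<close> by a line. On it, both forms and all coordinates with
  index in \<open>{1..n}\<close> are univariate polynomials that are not identically zero, so some parameter \<open>s\<close> avoids
  the zeros of all of them.
\<close>
lemma torus_nonvanishing_common:
  fixes f g :: "(nat \<Rightarrow>\<^sub>0 nat, 'k::field_char_0) mpoly"
  assumes v: "v \<in> torus n S" "mpoly_eval f (veronese_coords A v) \<noteq> 0"
    and w: "w \<in> torus n S" "mpoly_eval g (veronese_coords A w) \<noteq> 0"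
  shows "\<exists>u\<in>torus n S. mpoly_eval f (veronese_coords A u) \<noteq> 0 \<and> mpoly_eval g (veronese_coords A u) \<noteq> 0"
proof -
  define u where "u s i = (1 - s) * v i + s * w i" for s i
  have u01: "u 0 = v" "u 1 = w" by (auto simp: u_def)
  have u: "univariate (\<lambda>s. u s i)" for i
    unfolding u_def by (rule univariate_linear)
  have coords: "univariate (\<lambda>s. veronese_coords A (u s) a)" for a
    unfolding veronese_coords_def
    by (cases "a \<in> A") (auto intro: univariate_mpoly_eval u univariate_const)
  let ?B = "{s. mpoly_eval f (veronese_coords A (u s)) = 0} \<union>
    {s. mpoly_eval g (veronese_coords A (u s)) = 0} \<union> (\<Union>i\<in>{1..n}. {s. u s i = 0})"
  have "finite ?B"
  proof (intro finite_UnI finite_UN_I finite_atLeastAtMost)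
    show "finite {s. mpoly_eval f (veronese_coords A (u s)) = 0}"
      by (rule finite_zeros_univariate[of _ 0, OF univariate_mpoly_eval[OF coords]]) (simp add: u01 v)
    show "finite {s. mpoly_eval g (veronese_coords A (u s)) = 0}"
      by (rule finite_zeros_univariate[of _ 1, OF univariate_mpoly_eval[OF coords]]) (simp add: u01 w)
    show "finite {s. u s i = 0}" if "i \<in> {1..n}" for i
      by (rule finite_zeros_univariate[of _ 0, OF u]) (use v that in \<open>auto simp: u01 torus_def\<close>)
  qed
  from ex_new_if_finite[OF infinite_UNIV_char_0 this]
  obtain s where s: "s \<notin> ?B" by (rule exE)
  have "u s \<in> torus n S"
    using s v(1) w(1) by (auto simp: torus_def u_def)
  then show ?thesis using s by auto
qed

definition torus_closure ::
    "nat \<Rightarrow> (nat \<Rightarrow>\<^sub>0 nat) set \<Rightarrow> nat set \<Rightarrow> ((nat \<Rightarrow>\<^sub>0 nat) \<Rightarrow> 'k::field) set set" where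
  "torus_closure n A S = zariski A closure_of (veronese_point A ` torus n S)"

lemma torus_image_subset:
  assumes "A \<subseteq> nat_vectors n" "A \<noteq> {}"
  shows "veronese_point A ` torus n S \<subseteq> proj_space A"
  using veronese_point(1)[OF assms] by blast

lemma irreducible_torus_closure:
  assumes "A \<subseteq> nat_vectors n" "A \<noteq> {}"
  shows "irreducible_in (zariski A)
    (torus_closure n A S :: ((nat \<Rightarrow>\<^sub>0 nat) \<Rightarrow> 'k::field_char_0) set set)"
  unfolding torus_closure_def
proof (rule irreducible_in_closure[OF torus_image_subset[OF assms]])
  show "veronese_point A ` torus n S \<noteq> {}"
    using one_in_torus by blast
  fix f g :: "(nat \<Rightarrow>\<^sub>0 nat, 'k) mpoly"
  assume fg: "f \<in> homogeneous_mpolys A" "g \<in> homogeneous_mpolys A"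
    and "\<exists>P\<in>veronese_point A ` torus n S. \<not> vanishes_at f P"
      "\<exists>P\<in>veronese_point A ` torus n S. \<not> vanishes_at g P"
  then obtain v w where vw: "v \<in> torus n S" "\<not> vanishes_at f (veronese_point A v)"
    "w \<in> torus n S" "\<not> vanishes_at g (veronese_point A w)"
    by blast
  then obtain u where "u \<in> torus n S" "mpoly_eval f (veronese_coords A u) \<noteq> 0"
      "mpoly_eval g (veronese_coords A u) \<noteq> 0"
    using torus_nonvanishing_common[of v n S f A w g] fg
    by (auto simp: vanishes_at_veronese_point[OF assms])
  then show "\<exists>P\<in>veronese_point A ` torus n S. \<not> vanishes_at f P \<and> \<not> vanishes_at g P"
    using fg by (auto simp: vanishes_at_veronese_point[OF assms])
qed

lemma torus_closure_subset_projection: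
  assumes "A \<subseteq> nat_vectors n" "A \<noteq> {}"
  shows "torus_closure n A S \<subseteq> veronese_projection n A"
  unfolding torus_closure_def veronese_projection_def
  using veronese_point_in_image[OF assms] by (intro closure_of_mono) blast

lemma torus_closure_mono: "S \<subseteq> S' \<Longrightarrow> torus_closure n A S \<subseteq> torus_closure n A S'"
  unfolding torus_closure_def by (intro closure_of_mono image_mono) (auto simp: torus_def)

section \<open>A chain of torus closures\<close>

text \<open>
  Let \<open>x\<close> and \<open>y\<close> witness the pivot \<open>i\<close>. The corresponding binomial pulls back to
  \<open>v\<^sup>x - v\<^sup>y\<close>. This vanishes if only coordinates before \<open>i\<close> vary, and not at the point whose \<open>i\<close>-th
  coordinate is 2 and whose other coordinates are 1.
\<close>
lemma torus_closure_strict: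
  fixes A :: "(nat \<Rightarrow>\<^sub>0 nat) set"
  assumes A: "finite A" "A \<subseteq> nat_vectors n" "A \<noteq> {}"
    and i: "i \<in> pivots A" "i \<in> S'" and S: "S \<subseteq> S'" "\<forall>j\<in>S. j < i"
  shows "torus_closure n A S \<subset> (torus_closure n A S' :: ((nat \<Rightarrow>\<^sub>0 nat) \<Rightarrow> 'k::field_char_0) set set)"
proof -
  obtain t x y where "x \<in> sumset t A" "y \<in> sumset t A"
    and eq: "\<forall>j<i. Poly_Mapping.lookup x j = Poly_Mapping.lookup y j"
    and neq: "Poly_Mapping.lookup x i \<noteq> Poly_Mapping.lookup y i"
    using i(1) by (auto simp: pivots_def)
  then obtain m m' where m: "Poly_Mapping.keys m \<subseteq> A" "tdeg m = t" "x = weighted_sum m"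
    and m': "Poly_Mapping.keys m' \<subseteq> A" "tdeg m' = t" "y = weighted_sum m'"
    by (auto simp: sumset_eq_weighted_sum_image)
  have xy: "x \<in> nat_vectors n" "y \<in> nat_vectors n"
    using sumset_nat_vectors[OF A(2)] \<open>x \<in> sumset t A\<close> \<open>y \<in> sumset t A\<close> by auto
  define f :: "(nat \<Rightarrow>\<^sub>0 nat, 'k) mpoly"
    where "f = Poly_Mapping.single m 1 + Poly_Mapping.single m' (- 1)"
  have "Poly_Mapping.keys f \<subseteq> {m, m'}"
    unfolding f_def by (rule order_trans[OF keys_add]) auto
  then have "f \<in> mpolys_of_degree A t"
    using m m' by (auto simp: mpolys_of_degree_def mpolys_def)
  then have f: "f \<in> homogeneous_mpolys A"
    by (auto simp: homogeneous_mpolys_def)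
  have eval: "mpoly_eval f (veronese_coords A v) = monom_eval x v - monom_eval y v"
    if "v \<in> torus n R" for v R
  proof -
    have "v 0 = 1" using that by (simp add: torus_def)
    then show ?thesis
      using m m' by (simp add: f_def mpoly_eval_add monom_eval_veronese_coords[OF A(1)])
  qed
  have "mpoly_eval f (veronese_coords A v) = 0" if v: "v \<in> torus n S" for v
  proof -
    have "v j ^ Poly_Mapping.lookup x j = v j ^ Poly_Mapping.lookup y j" if "j \<in> {1..n}" for j
    proof (cases "j < i")
      case True
      then show ?thesis using eq by simp
    next
      case False
      then have "v j = 1" using v S(2) that by (auto simp: torus_def)
      then show ?thesis by simp
    qed
    moreover have "monom_eval z v = (\<Prod>j\<in>{1..n}. v j ^ Poly_Mapping.lookup z j)"
      if "z \<in> nat_vectors n" for z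
      by (rule monom_eval_superset) (use that in \<open>auto simp: nat_vectors_def\<close>)
    ultimately show ?thesis
      using eval[OF v] xy by simp
  qed
  then have "\<forall>P\<in>veronese_point A ` torus n S. vanishes_at f P"
    using f by (auto simp: vanishes_at_veronese_point[OF A(2,3)])
  then have van: "\<forall>P\<in>torus_closure n A S. vanishes_at f P"
    unfolding torus_closure_def
    using vanishes_on_closure_iff[OF f torus_image_subset[OF A(2,3)]] by blast
  have "i \<in> {1..n}" using pivots_subset[OF A(2)] i(1) by blast
  then have w: "one_except n i (2::'k) \<in> torus n S'"
    using i(2) by (intro one_except_in_torus) auto
  have "(2::'k) ^ Poly_Mapping.lookup x i \<noteq> 2 ^ Poly_Mapping.lookup y i"
    using neq by (simp add: power_two_eq_iff)
  then have "\<not> vanishes_at f (veronese_point A (one_except n i (2::'k)))"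
    using eval[OF w] xy f
    by (simp add: vanishes_at_veronese_point[OF A(2,3) w] monom_eval_one_except)
  moreover have "veronese_point A (one_except n i (2::'k)) \<in> torus_closure n A S'"
    unfolding torus_closure_def
    using w closure_of_subset[of "veronese_point A ` torus n S'" "zariski A"]
      torus_image_subset[OF A(2,3), of S'] by (auto simp: topspace_zariski)
  ultimately show ?thesis
    using van torus_closure_mono[OF S(1)] by blast
qed

text \<open>
  Let the torus coordinates at the pivots vary one after the other, in increasing order.
\<close>
lemma card_pivots_le_dim:
  fixes A :: "(nat \<Rightarrow>\<^sub>0 nat) set"
  assumes A: "finite A" "A \<subseteq> nat_vectors n" "A \<noteq> {}"
  shows "enat (card (pivots A)) \<le>
    variety_dim A (veronese_projection n A :: ((nat \<Rightarrow>\<^sub>0 nat) \<Rightarrow> 'k::field_char_0) set set)"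
proof -
  define X :: "((nat \<Rightarrow>\<^sub>0 nat) \<Rightarrow> 'k) set topology"
    where "X = subtopology (zariski A) (veronese_projection n A)"
  define ps where "ps = sorted_list_of_set (pivots A)"
  have "finite (pivots A)"
    using pivots_subset[OF A(2)] finite_subset by blast
  then have ps: "set ps = pivots A" "length ps = card (pivots A)" "sorted_wrt (<) ps"
    by (auto simp: ps_def)
  define Z :: "nat \<Rightarrow> ((nat \<Rightarrow>\<^sub>0 nat) \<Rightarrow> 'k) set set"
    where "Z k = torus_closure n A (set (take k ps))" for k
  have "closedin X (Z k) \<and> irreducible_in X (Z k)" for k
  proof
    have sub: "Z k \<subseteq> veronese_projection n A"
      unfolding Z_def by (rule torus_closure_subset_projection[OF A(2,3)])
    show "closedin X (Z k)"
      unfolding X_def using sub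
      by (intro closedin_subset_topspace) (simp_all add: Z_def torus_closure_def)
    show "irreducible_in X (Z k)"
      unfolding X_def irreducible_in_subtopology[OF sub]
      unfolding Z_def by (rule irreducible_torus_closure[OF A(2,3)])
  qed
  moreover have "Z k \<subset> Z (Suc k)" if k: "k < length ps" for k
    unfolding Z_def
  proof (rule torus_closure_strict[OF A, of "ps ! k"])
    show "ps ! k \<in> pivots A" using k ps(1) nth_mem by blast
    show "ps ! k \<in> set (take (Suc k) ps)" using k by (simp add: take_Suc_conv_app_nth)
    show "set (take k ps) \<subseteq> set (take (Suc k) ps)" by (simp add: set_take_subset_set_take)
    show "\<forall>j\<in>set (take k ps). j < ps ! k"
      using ps(3) k by (auto simp: in_set_conv_nth sorted_wrt_iff_nth_less)
  qed
  ultimately have "enat (card (pivots A)) \<in> {enat m | m. \<exists>Z :: nat \<Rightarrow> ((nat \<Rightarrow>\<^sub>0 nat) \<Rightarrow> 'k) set set.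
     (\<forall>i\<le>m. closedin X (Z i) \<and> irreducible_in X (Z i)) \<and> (\<forall>i<m. Z i \<subset> Z (Suc i))}"
    unfolding ps(2)[symmetric] by blast
  then show ?thesis
    unfolding variety_dim_def top_dim_def X_def[symmetric] by (rule Sup_upper)
qed

section \<open>Linearly independent forms along a chain of irreducible closed sets\<close>

lemma mpolys_of_degree_add:
  assumes "f \<in> mpolys_of_degree J t" "g \<in> mpolys_of_degree J t"
  shows "f + g \<in> mpolys_of_degree J t"
  using assms keys_add[of f g] unfolding mpolys_of_degree_def mpolys_def by blast

lemma mpolys_of_degree_mult:
  assumes "f \<in> mpolys_of_degree J s" "g \<in> mpolys_of_degree J t"
  shows "f * g \<in> mpolys_of_degree J (s + t)"
  using assms mpolys_mult keys_mult[of f g]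
  by (fastforce simp: mpolys_of_degree_def tdeg_add)

lemma mpoly_const_in_mpolys_of_degree: "mpoly_const c \<in> mpolys_of_degree J 0"
  by (auto simp: mpoly_const_def mpolys_of_degree_def mpolys_def)

lemma mpolys_of_degree_scale:
  "f \<in> mpolys_of_degree J t \<Longrightarrow> mpoly_const c * f \<in> mpolys_of_degree J t"
  using mpolys_of_degree_mult[OF mpoly_const_in_mpolys_of_degree] by (metis add_0)

lemma mpolys_of_degree_sum:
  "(\<And>i. i \<in> I \<Longrightarrow> f i \<in> mpolys_of_degree J t) \<Longrightarrow> (\<Sum>i\<in>I. f i) \<in> mpolys_of_degree J t"
proof (induction I rule: infinite_finite_induct)
  case (insert i I)
  then show ?case by (simp add: mpolys_of_degree_add)
qed (simp_all add: mpolys_of_degree_def mpolys_def)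

lemma mpolys_of_degree_one: "1 \<in> mpolys_of_degree J 0"
  using mpoly_const_in_mpolys_of_degree[of 1] by (simp add: mpoly_const_def)

lemma mpolys_of_degree_power:
  "f \<in> mpolys_of_degree J t \<Longrightarrow> f ^ k \<in> mpolys_of_degree J (k * t)"
  by (induction k) (auto intro: mpolys_of_degree_one mpolys_of_degree_mult)

lemma mpolys_of_degree_homogeneous: "f \<in> mpolys_of_degree J t \<Longrightarrow> f \<in> homogeneous_mpolys J"
  by (auto simp: homogeneous_mpolys_def)

lemma mpoly_eval_const [simp]: "mpoly_eval (mpoly_const c) v = c"
  by (simp add: mpoly_const_def)

lemma mpoly_eval_one [simp]: "mpoly_eval 1 v = 1"
  using mpoly_eval_const[of 1 v] by (simp add: mpoly_const_def)

lemma mpoly_eval_power: "mpoly_eval (f ^ k) v = mpoly_eval f v ^ k"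
  by (induction k) (simp_all add: mpoly_eval_mult)

text \<open>
  Linear independence modulo the forms that vanish on \<open>Z\<close>.
\<close>
definition independent_on ::
    "('i \<Rightarrow> 'k::field) set set \<Rightarrow> ('i, 'k) mpoly set \<Rightarrow> bool" where
  "independent_on Z B \<longleftrightarrow>
     (\<forall>\<alpha>. (\<forall>P\<in>Z. vanishes_at (\<Sum>f\<in>B. mpoly_const (\<alpha> f) * f) P) \<longrightarrow> (\<forall>f\<in>B. \<alpha> f = 0))"

lemma independent_on_mono: "independent_on Z B \<Longrightarrow> Z \<subseteq> Y \<Longrightarrow> independent_on Y B"
  unfolding independent_on_def by blast

lemma independent_on_nonvanishing:
  assumes "independent_on Z B" "finite B" "f \<in> B"
  shows "\<exists>P\<in>Z. \<not> vanishes_at f P"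
proof (rule ccontr)
  assume van: "\<not> (\<exists>P\<in>Z. \<not> vanishes_at f P)"
  have "(\<Sum>g\<in>B. mpoly_const (if g = f then 1 else 0) * g) = (\<Sum>g\<in>{f}. g)"
    by (rule sum.mono_neutral_cong_right) (use assms in \<open>auto simp: mpoly_const_def\<close>)
  then have "\<forall>P\<in>Z. vanishes_at (\<Sum>g\<in>B. mpoly_const (if g = f then 1 else 0) * g) P"
    using van by simp
  then have "\<forall>g\<in>B. (if g = f then 1 else 0) = (0::'b)"
    using assms(1)[unfolded independent_on_def, rule_format, of "\<lambda>g. if g = f then 1 else 0"]
    by blast
  then show False using assms(3) by auto
qed

lemma independent_on_singleton:
  assumes "P \<in> Z" "\<not> vanishes_at f P"
  shows "independent_on Z {f}"
  using assms by (auto simp: independent_on_def vanishes_at_def mpoly_eval_mult)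

text \<open>
  In a relation, restricting to \<open>Z'\<close> kills the multiples of \<open>g\<close>, hence the coefficients on \<open>B'\<close>
  are zero. What remains is \<open>g\<close> times a combination of \<open>B\<close> that vanishes on the irreducible set
  \<open>Z\<close>, so the combination itself vanishes there.
\<close>
lemma independent_on_extend:
  fixes g :: "('i::linorder, 'k::field) mpoly"
  assumes Z: "irreducible_in (zariski J) Z" "Z' \<subseteq> Z"
    and g: "g \<in> homogeneous_mpolys J" "\<forall>P\<in>Z'. vanishes_at g P" "\<exists>P\<in>Z. \<not> vanishes_at g P"
    and B: "finite B" "B \<subseteq> mpolys_of_degree J e" "independent_on Z B"
    and B': "finite B'" "independent_on Z' B'"
  shows "independent_on Z (B' \<union> (*) g ` B)" "card (B' \<union> (*) g ` B) = card B' + card B"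
proof -
  have "g \<noteq> 0" using g(3) by (auto simp: vanishes_at_def)
  then have inj: "inj_on ((*) g) B" by (simp add: inj_on_def)
  have disj: "B' \<inter> (*) g ` B = {}"
  proof -
    have "\<forall>P\<in>Z'. vanishes_at (g * b) P" for b
      using g(2) by (simp add: vanishes_at_def mpoly_eval_mult)
    then show ?thesis using independent_on_nonvanishing[OF B'(2,1)] by blast
  qed
  show "card (B' \<union> (*) g ` B) = card B' + card B"
    using card_Un_disjoint[OF B'(1) finite_imageI[OF B(1)] disj] card_image[OF inj] by simp
  show "independent_on Z (B' \<union> (*) g ` B)"
    unfolding independent_on_def
  proof (intro allI impI)
    fix \<alpha>
    assume van: "\<forall>P\<in>Z. vanishes_at (\<Sum>f\<in>B' \<union> (*) g ` B. mpoly_const (\<alpha> f) * f) P"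
    define H where "H = (\<Sum>b\<in>B. mpoly_const (\<alpha> (g * b)) * b)"
    define H' where "H' = (\<Sum>f\<in>B'. mpoly_const (\<alpha> f) * f)"
    have sum: "(\<Sum>f\<in>B' \<union> (*) g ` B. mpoly_const (\<alpha> f) * f) = H' + g * H"
      unfolding H_def H'_def sum.union_disjoint[OF B'(1) finite_imageI[OF B(1)] disj]
      by (simp add: sum.reindex[OF inj] sum_distrib_left mult.left_commute)
    have "\<forall>P\<in>Z'. vanishes_at (H' + g * H) P"
      using van Z(2) unfolding sum by blast
    then have "\<forall>P\<in>Z'. vanishes_at H' P"
      using g(2) by (simp add: vanishes_at_def mpoly_eval_add mpoly_eval_mult)
    then have \<alpha>': "\<forall>f\<in>B'. \<alpha> f = 0"
      using B'(2) unfolding independent_on_def H'_def by blast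
    then have "H' = 0" by (simp add: H'_def mpoly_const_def)
    then have "\<forall>P\<in>Z. vanishes_at (g * H) P"
      using van unfolding sum by simp
    moreover have "H \<in> mpolys_of_degree J e"
      unfolding H_def using B(2) by (intro mpolys_of_degree_sum mpolys_of_degree_scale) auto
    ultimately have "\<forall>P\<in>Z. vanishes_at H P"
      using irreducible_vanishes_mult[OF Z(1) g(1)] g(3) mpolys_of_degree_homogeneous by blast
    then have "\<forall>b\<in>B. \<alpha> (g * b) = 0"
      using B(3)[unfolded independent_on_def, rule_format, of "\<lambda>b. \<alpha> (g * b)"]
      unfolding H_def by blast
    with \<alpha>' show "\<forall>f\<in>B' \<union> (*) g ` B. \<alpha> f = 0" by blast
  qed
qed

lemma proj_space_coordinates:
  assumes "P \<in> proj_space J"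
  obtains v where "v \<in> P" "v \<in> punctured_space J"
proof -
  obtain v where "v \<in> P"
    using assms equiv_proportional by (metis ex_in_conv in_quotient_imp_non_empty proj_space_def)
  moreover have "P \<subseteq> punctured_space J"
    using assms equiv_proportional by (metis in_quotient_imp_subset proj_space_def)
  ultimately show ?thesis using that by blast
qed

text \<open>
  Multiply by a power of a coordinate that does not vanish identically on \<open>Z\<close>.
\<close>
lemma raise_degree:
  fixes f :: "('i, 'k::field) mpoly"
  assumes Z: "irreducible_in (zariski J) Z"
    and f: "f \<in> mpolys_of_degree J d" "\<exists>P\<in>Z. \<not> vanishes_at f P" "d \<le> D"
  obtains g where "g \<in> mpolys_of_degree J D" "\<exists>P\<in>Z. \<not> vanishes_at g P"
    "\<And>P. vanishes_at f P \<Longrightarrow> vanishes_at g P"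
proof -
  have ZJ: "Z \<subseteq> proj_space J"
    using Z by (simp add: irreducible_in_def topspace_zariski)
  obtain P where P: "P \<in> Z" using f(2) by blast
  then obtain v where v: "v \<in> P" "v \<in> punctured_space J"
    using ZJ proj_space_coordinates by blast
  then obtain a where a: "a \<in> J" "v a \<noteq> 0"
    by (auto simp: punctured_space_def)
  define w :: "('i, 'k) mpoly" where "w = Poly_Mapping.single (Poly_Mapping.single a 1) 1"
  have "w \<in> mpolys_of_degree J 1"
    using a(1) by (auto simp: w_def mpolys_of_degree_def mpolys_def tdeg_single)
  then have w: "w ^ (D - d) \<in> mpolys_of_degree J (D - d)"
    using mpolys_of_degree_power[of w J 1 "D - d"] by simp
  have "mpoly_eval (w ^ (D - d)) v \<noteq> 0"
    using a(2) by (simp add: mpoly_eval_power w_def monom_eval_single)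
  then have "\<exists>P\<in>Z. \<not> vanishes_at (w ^ (D - d)) P"
    using P v by (auto simp: vanishes_at_def)
  then have "\<exists>P\<in>Z. \<not> vanishes_at (f * w ^ (D - d)) P"
    using irreducible_vanishes_mult[OF Z mpolys_of_degree_homogeneous[OF f(1)]
        mpolys_of_degree_homogeneous[OF w]] f(2) by blast
  moreover have "f * w ^ (D - d) \<in> mpolys_of_degree J D"
    using mpolys_of_degree_mult[OF f(1) w] f(3) by simp
  moreover have "vanishes_at (f * w ^ (D - d)) P" if "vanishes_at f P" for P
    using that by (simp add: vanishes_at_def mpoly_eval_mult)
  ultimately show ?thesis using that by blast
qed

text \<open>
  A chain of length \<open>m\<close> forces the Hilbert function of its top to grow with order at least \<open>m\<close>.
  Choose forms of a common degree \<open>D\<close>, the \<open>k\<close>-th vanishing on \<open>Z k\<close> but not on \<open>Z (Suc k)\<close>. Then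
  \<open>independent_on_extend\<close> builds the families for \<open>(Suc k, Suc q)\<close> from those for \<open>(k, Suc q)\<close> and
  \<open>(Suc k, q)\<close>, and the cardinalities follow Pascal's rule.
\<close>
lemma chain_independent_forms:
  fixes Z :: "nat \<Rightarrow> ('i::linorder \<Rightarrow> 'k::field) set set"
  assumes Z: "\<And>k. k \<le> m \<Longrightarrow> closedin (zariski J) (Z k)"
      "\<And>k. k \<le> m \<Longrightarrow> irreducible_in (zariski J) (Z k)" "\<And>k. k < m \<Longrightarrow> Z k \<subset> Z (Suc k)"
  shows "\<exists>D\<ge>1. \<forall>q. \<exists>B. finite B \<and> B \<subseteq> mpolys_of_degree J (q * D) \<and> independent_on (Z m) B \<and>
    card B = (q + m) choose m"
proof -
  have ZJ: "Z k \<subseteq> proj_space J" "Z k \<noteq> {}" if "k \<le> m" for k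
    using Z(2)[OF that] by (auto simp: irreducible_in_def topspace_zariski)
  have "\<exists>f d. f \<in> mpolys_of_degree J d \<and> (\<forall>P\<in>Z k. vanishes_at f P) \<and>
      (\<exists>P\<in>Z (Suc k). \<not> vanishes_at f P)" if k: "k < m" for k
  proof -
    obtain F where F: "F \<subseteq> homogeneous_mpolys J" "Z k = zero_locus J F"
      using Z(1)[of k] k unfolding closedin_zariski by auto
    obtain P where P: "P \<in> Z (Suc k)" "P \<notin> Z k" using Z(3)[OF k] by blast
    then have "P \<in> proj_space J" using ZJ(1)[of "Suc k"] k by auto
    then obtain f where "f \<in> F" "\<not> vanishes_at f P"
      using P(2) F(2) by (auto simp: zero_locus_def)
    moreover have "\<forall>P\<in>Z k. vanishes_at f P"
      using \<open>f \<in> F\<close> F(2) by (auto simp: zero_locus_def)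
    moreover obtain d where "f \<in> mpolys_of_degree J d"
      using \<open>f \<in> F\<close> F(1) by (auto simp: homogeneous_mpolys_def)
    ultimately show ?thesis
      using P(1) by blast
  qed
  then obtain f d where f: "\<And>k. k < m \<Longrightarrow> f k \<in> mpolys_of_degree J (d k)"
      "\<And>k. k < m \<Longrightarrow> \<forall>P\<in>Z k. vanishes_at (f k) P"
      "\<And>k. k < m \<Longrightarrow> \<exists>P\<in>Z (Suc k). \<not> vanishes_at (f k) P"
    by metis
  \<comment> \<open>Any common bound of the degrees will do; it must be positive so that \<open>q * D\<close> grows with \<open>q\<close>.\<close>
  define D where "D = Suc (\<Sum>k<m. d k)"
  have "\<exists>g. g \<in> mpolys_of_degree J D \<and> (\<forall>P\<in>Z k. vanishes_at g P) \<and>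
      (\<exists>P\<in>Z (Suc k). \<not> vanishes_at g P)" if k: "k < m" for k
  proof -
    have "d k \<le> D"
      using member_le_sum[of k "{..<m}" d] k by (simp add: D_def)
    moreover have "irreducible_in (zariski J) (Z (Suc k))" using Z(2)[of "Suc k"] k by simp
    ultimately obtain g where "g \<in> mpolys_of_degree J D" "\<exists>P\<in>Z (Suc k). \<not> vanishes_at g P"
      "\<And>P. vanishes_at (f k) P \<Longrightarrow> vanishes_at g P"
      using raise_degree[OF _ f(1)[OF k] f(3)[OF k]] by blast
    then show ?thesis using f(2)[OF k] by blast
  qed
  then obtain g where g: "\<And>k. k < m \<Longrightarrow> g k \<in> mpolys_of_degree J D"
      "\<And>k. k < m \<Longrightarrow> \<forall>P\<in>Z k. vanishes_at (g k) P"
      "\<And>k. k < m \<Longrightarrow> \<exists>P\<in>Z (Suc k). \<not> vanishes_at (g k) P"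
    by metis
  have single: "\<exists>B. finite B \<and> B \<subseteq> mpolys_of_degree J e \<and> independent_on (Z k) B \<and> card B = 1"
    if k: "k \<le> m" for k e
  proof -
    have "\<exists>P\<in>Z k. \<not> vanishes_at 1 P"
    proof -
      obtain P where "P \<in> Z k" "P \<in> proj_space J" using ZJ[OF k] by blast
      moreover from this obtain v where "v \<in> P" using proj_space_coordinates by blast
      ultimately show ?thesis by (auto simp: vanishes_at_def)
    qed
    then obtain h where h: "h \<in> mpolys_of_degree J e" "\<exists>P\<in>Z k. \<not> vanishes_at h P"
      using raise_degree[OF Z(2)[OF k] mpolys_of_degree_one] by blast
    then have "independent_on (Z k) {h}"
      using independent_on_singleton by blast
    then show ?thesis using h(1) by (intro exI[of _ "{h}"]) auto
  qed
  have "\<exists>B. finite B \<and> B \<subseteq> mpolys_of_degree J (q * D) \<and> independent_on (Z k) B \<and>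
    card B = (q + k) choose k" if "k \<le> m" for k q
    using that
  proof (induction k arbitrary: q)
    case 0
    then show ?case using single[of 0 "q * D"] by simp
  next
    case (Suc k)
    then have k: "k < m" "k \<le> m" by auto
    note IH = Suc.IH
    show ?case
    proof (induction q)
      case 0
      then show ?case using single[OF Suc.prems, of 0] by simp
    next
      case (Suc q)
      obtain B where B: "finite B" "B \<subseteq> mpolys_of_degree J (q * D)" "independent_on (Z (Suc k)) B"
        "card B = (q + Suc k) choose Suc k"
        using Suc.IH by blast
      obtain B' where B': "finite B'" "B' \<subseteq> mpolys_of_degree J (Suc q * D)" "independent_on (Z k) B'"
        "card B' = (Suc q + k) choose k"
        using IH[OF k(2), of "Suc q"] by blast
      have sub: "Z k \<subseteq> Z (Suc k)" using Z(3)[OF k(1)] by blast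
      have irr: "irreducible_in (zariski J) (Z (Suc k))" using Z(2)[of "Suc k"] k by simp
      note ext = independent_on_extend[OF irr sub mpolys_of_degree_homogeneous[OF g(1)[OF k(1)]]
          g(2)[OF k(1)] g(3)[OF k(1)] B(1-3) B'(1,3)]
      have "(*) (g k) ` B \<subseteq> mpolys_of_degree J (Suc q * D)"
        using B(2) mpolys_of_degree_mult[OF g(1)[OF k(1)]] by auto
      then show ?case
        using ext B(1,4) B' by (intro exI[of _ "B' \<union> (*) (g k) ` B"]) simp
    qed
  qed
  then show ?thesis
    by (intro exI[of _ D]) (auto simp: D_def)
qed

section \<open>Chains are bounded by the growth of sumsets\<close>

text \<open>
  Gaussian elimination: a homogeneous system with fewer equations than unknowns has a nontrivial
  solution.
\<close>
lemma underdetermined_system: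
  fixes a :: "'b \<Rightarrow> 'c \<Rightarrow> 'k::field"
  assumes "finite C" "finite B" "card C < card B"
  shows "\<exists>\<alpha>. (\<exists>b\<in>B. \<alpha> b \<noteq> 0) \<and> (\<forall>c\<in>C. (\<Sum>b\<in>B. \<alpha> b * a b c) = 0)"
  using assms
proof (induction C arbitrary: a B rule: finite_induct)
  case empty
  then have "B \<noteq> {}" by auto
  then show ?case by (intro exI[of _ "\<lambda>_. 1"]) auto
next
  case (insert c C)
  show ?case
  proof (cases "\<forall>b\<in>B. a b c = 0")
    case True
    have "card C < card B" using insert.hyps insert.prems by simp
    from insert.IH[OF insert.prems(1) this, of a] show ?thesis
      using True by auto
  next
    case False
    then obtain b0 where b0: "b0 \<in> B" "a b0 c \<noteq> 0" by blast
    \<comment> \<open>Use the equation \<open>c\<close> to eliminate the unknown \<open>b0\<close>.\<close>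
    define B1 where "B1 = B - {b0}"
    have B1: "finite B1" "card C < card B1" "B = insert b0 B1" "b0 \<notin> B1"
      using insert b0 by (auto simp: B1_def)
    obtain \<alpha> where \<alpha>: "\<exists>b\<in>B1. \<alpha> b \<noteq> 0"
      "\<And>c'. c' \<in> C \<Longrightarrow> (\<Sum>b\<in>B1. \<alpha> b * (a b c' - a b c / a b0 c * a b0 c')) = 0"
      using insert.IH[OF B1(1,2), of "\<lambda>b c'. a b c' - a b c / a b0 c * a b0 c'"] by blast
    define s where "s = (\<Sum>b\<in>B1. \<alpha> b * a b c) / a b0 c"
    define \<beta> where "\<beta> = \<alpha>(b0 := - s)"
    have \<beta>: "(\<Sum>b\<in>B. \<beta> b * a b c') = (\<Sum>b\<in>B1. \<alpha> b * a b c') - s * a b0 c'" for c'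
    proof -
      have "(\<Sum>b\<in>B1. \<beta> b * a b c') = (\<Sum>b\<in>B1. \<alpha> b * a b c')"
        using B1(4) by (intro sum.cong) (auto simp: \<beta>_def)
      then show ?thesis using B1 by (simp add: \<beta>_def)
    qed
    have "(\<Sum>b\<in>B. \<beta> b * a b c') = 0" if "c' \<in> insert c C" for c'
    proof (cases "c' = c")
      case True
      then show ?thesis using b0(2) by (simp add: \<beta> s_def)
    next
      case False
      then have "c' \<in> C" using that by blast
      have "(\<Sum>b\<in>B1. \<alpha> b * (a b c' - a b c / a b0 c * a b0 c')) =
          (\<Sum>b\<in>B1. \<alpha> b * a b c') - s * a b0 c'"
        by (simp add: s_def sum_divide_distrib sum_distrib_right right_diff_distrib sum_subtractf
              mult.assoc)
      then show ?thesis using \<alpha>(2)[OF \<open>c' \<in> C\<close>] \<beta> by simp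
    qed
    moreover have "\<exists>b\<in>B. \<beta> b \<noteq> 0"
      using \<alpha>(1) B1 by (auto simp: \<beta>_def)
    ultimately show ?thesis by blast
  qed
qed

lemma fibre_coeff_superset:
  assumes "finite M" "Poly_Mapping.keys f \<subseteq> M"
  shows "fibre_coeff f c = (\<Sum>m | m \<in> M \<and> weighted_sum m = c. Poly_Mapping.lookup f m)"
  unfolding fibre_coeff_def
  by (rule sum.mono_neutral_left) (use assms in \<open>auto simp: in_keys_iff\<close>)

lemma fibre_coeff_add: "fibre_coeff (f + g) c = fibre_coeff f c + fibre_coeff g c"
proof -
  define M where "M = Poly_Mapping.keys f \<union> Poly_Mapping.keys g"
  have M: "finite M" "Poly_Mapping.keys f \<subseteq> M" "Poly_Mapping.keys g \<subseteq> M"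
    "Poly_Mapping.keys (f + g) \<subseteq> M"
    using keys_add[of f g] by (auto simp: M_def)
  show ?thesis
    by (simp add: fibre_coeff_superset[OF M(1)] M lookup_add sum.distrib)
qed

lemma fibre_coeff_zero [simp]: "fibre_coeff 0 c = 0"
  by (simp add: fibre_coeff_def)

lemma lookup_const_mult:
  "Poly_Mapping.lookup (mpoly_const a * f) m = a * Poly_Mapping.lookup f m"
  unfolding mpoly_const_def mult_map_scale_conv_mult[symmetric]
  by (simp add: Poly_Mapping.map.rep_eq when_def)

lemma fibre_coeff_scale: "fibre_coeff (mpoly_const a * f) c = a * fibre_coeff f c"
proof -
  have "Poly_Mapping.keys (mpoly_const a * f) \<subseteq> Poly_Mapping.keys f"
    by (auto simp: in_keys_iff lookup_const_mult)
  then show ?thesis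
    by (simp add: fibre_coeff_superset[of "Poly_Mapping.keys f"] lookup_const_mult sum_distrib_left)
qed

lemma fibre_coeff_diff: "fibre_coeff (f - g) c = fibre_coeff f c - fibre_coeff g c"
  using fibre_coeff_add[of "f - g" g c] by simp

lemma fibre_coeff_sum: "fibre_coeff (\<Sum>i\<in>I. f i) c = (\<Sum>i\<in>I. fibre_coeff (f i) c)"
  by (induction I rule: infinite_finite_induct) (simp_all add: fibre_coeff_add)

lemma fibre_coeff_outside:
  assumes "f \<in> mpolys_of_degree A t" "c \<notin> sumset t A"
  shows "fibre_coeff f c = 0"
proof -
  have "{m. m \<in> Poly_Mapping.keys f \<and> weighted_sum m = c} = {}"
    using assms by (auto simp: sumset_eq_weighted_sum_image mpolys_of_degree_def mpolys_def)
  then show ?thesis by (simp only: fibre_coeff_def sum.empty)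
qed

lemma vanishes_on_projection_iff:
  fixes f :: "(nat \<Rightarrow>\<^sub>0 nat, 'k::field_char_0) mpoly"
  assumes "finite A" "A \<subseteq> nat_vectors n" "A \<noteq> {}" "f \<in> mpolys_of_degree A t"
  shows "(\<forall>P\<in>veronese_projection n A. vanishes_at f P) \<longleftrightarrow> (\<forall>c. fibre_coeff f c = 0)"
proof -
  have "veronese_image n A \<subseteq> (proj_space A :: ((nat \<Rightarrow>\<^sub>0 nat) \<Rightarrow> 'k) set set)"
    by (auto simp: veronese_image_def)
  then show ?thesis
    unfolding veronese_projection_def
    using vanishes_on_closure_iff[OF mpolys_of_degree_homogeneous[OF assms(4)]]
      vanishes_on_image_iff[OF assms] by blast
qed

text \<open>
  A combination of \<open>B\<close> vanishes on the variety as soon as its fibre coefficients at the elements of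
  the sumset vanish, which is one linear condition for each of them.
\<close>
lemma card_independent_le:
  fixes B :: "(nat \<Rightarrow>\<^sub>0 nat, 'k::field_char_0) mpoly set"
  assumes A: "finite A" "A \<subseteq> nat_vectors n" "A \<noteq> {}"
    and B: "finite B" "B \<subseteq> mpolys_of_degree A t" "independent_on (veronese_projection n A) B"
  shows "card B \<le> card (sumset t A)"
proof (rule ccontr)
  assume "\<not> card B \<le> card (sumset t A)"
  then obtain \<alpha> where \<alpha>: "\<exists>b\<in>B. \<alpha> b \<noteq> 0"
    "\<And>c. c \<in> sumset t A \<Longrightarrow> (\<Sum>b\<in>B. \<alpha> b * fibre_coeff b c) = 0"
    using underdetermined_system[OF finite_sumset[OF A(1), of t] B(1), of fibre_coeff] by auto
  let ?F = "\<Sum>b\<in>B. mpoly_const (\<alpha> b) * b"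
  have F: "?F \<in> mpolys_of_degree A t"
    using B(2) by (intro mpolys_of_degree_sum mpolys_of_degree_scale) auto
  have "fibre_coeff ?F c = 0" for c
  proof (cases "c \<in> sumset t A")
    case True
    then show ?thesis using \<alpha>(2) by (simp add: fibre_coeff_sum fibre_coeff_scale)
  qed (rule fibre_coeff_outside[OF F])
  then have "\<forall>P\<in>veronese_projection n A. vanishes_at ?F P"
    using vanishes_on_projection_iff[OF A F] by blast
  then show False
    using B(3) \<alpha>(1) unfolding independent_on_def by blast
qed

lemma dim_le_degree:
  fixes p :: "rat poly"
  assumes A: "finite A" "A \<subseteq> nat_vectors n" "A \<noteq> {}"
    and p: "\<forall>\<^sub>F t in sequentially. of_nat (card (sumset t A)) = poly p (of_nat t)"
  shows "variety_dim A (veronese_projection n A :: ((nat \<Rightarrow>\<^sub>0 nat) \<Rightarrow> 'k::field_char_0) set set)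
    \<le> enat (degree p)"
  unfolding variety_dim_def top_dim_def
proof (rule Sup_least, clarsimp)
  let ?Y = "veronese_projection n A :: ((nat \<Rightarrow>\<^sub>0 nat) \<Rightarrow> 'k) set set"
  let ?X = "subtopology (zariski A) ?Y"
  fix m and Z :: "nat \<Rightarrow> ((nat \<Rightarrow>\<^sub>0 nat) \<Rightarrow> 'k) set set"
  assume Z: "\<forall>i\<le>m. closedin ?X (Z i) \<and> irreducible_in ?X (Z i)" "\<forall>i<m. Z i \<subset> Z (Suc i)"
  have sub: "Z k \<subseteq> ?Y" if "k \<le> m" for k
    using Z(1) that closedin_subset[of ?X "Z k"] by auto
  have Y: "closedin (zariski A) ?Y"
    by (simp add: veronese_projection_def)
  have "\<exists>D\<ge>1. \<forall>q. \<exists>B. finite B \<and> B \<subseteq> mpolys_of_degree A (q * D) \<and> independent_on (Z m) B \<and>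
      card B = (q + m) choose m"
  proof (rule chain_independent_forms)
    fix k assume "k \<le> m"
    then show "closedin (zariski A) (Z k)"
      using Z(1) closedin_trans_full[OF _ Y] by blast
    show "irreducible_in (zariski A) (Z k)"
      using Z(1) \<open>k \<le> m\<close> irreducible_in_subtopology[OF sub] by blast
  qed (use Z(2) in blast)
  then obtain D where D: "D \<ge> 1" "\<And>q. \<exists>B. finite B \<and> B \<subseteq> mpolys_of_degree A (q * D) \<and>
      independent_on (Z m) B \<and> card B = (q + m) choose m"
    by blast
  have "(q + m) choose m \<le> card (sumset (q * D) A)" for q
  proof -
    obtain B where B: "finite B" "B \<subseteq> mpolys_of_degree A (q * D)"
      "independent_on (Z m) B" "card B = (q + m) choose m"
      using D(2) by blast
    from card_independent_le[OF A B(1,2) independent_on_mono[OF B(3) sub]] B(4) show ?thesis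
      by simp
  qed
  then show "m \<le> degree p"
    using degree_ge_if_binomial_le[OF p D(1)] by blast
qed

section \<open>The Hilbert function of the coordinate ring\<close>

lemma mpolys_add: "f \<in> mpolys J \<Longrightarrow> g \<in> mpolys J \<Longrightarrow> f + g \<in> mpolys J"
  using keys_add[of f g] unfolding mpolys_def by blast

lemma mpolys_uminus: "f \<in> mpolys J \<Longrightarrow> - f \<in> mpolys J"
  by (simp add: mpolys_def)

lemma mpolys_const: "mpoly_const c \<in> mpolys J"
  using mpoly_const_in_mpolys_of_degree[of c J] by (simp add: mpolys_of_degree_def)

lemma mpolys_zero: "0 \<in> mpolys J"
  by (simp add: mpolys_def)

lemma mpolys_one: "1 \<in> mpolys J"
  using mpolys_const[of 1 J] by (simp add: mpoly_const_def)

lemma mpoly_ring_simps [simp]: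
  "carrier (mpoly_ring J) = mpolys J" "monoid.mult (mpoly_ring J) = (*)"
  "one (mpoly_ring J) = 1" "zero (mpoly_ring J) = 0" "add (mpoly_ring J) = (+)"
  by (simp_all add: mpoly_ring_def)

lemma cring_mpoly_ring: "cring (mpoly_ring J :: ('i, 'k::comm_ring_1) mpoly ring)"
proof (rule cringI)
  show "abelian_group (mpoly_ring J :: ('i, 'k) mpoly ring)"
  proof (rule abelian_groupI)
    fix f :: "('i, 'k) mpoly" assume "f \<in> carrier (mpoly_ring J)"
    then show "\<exists>g\<in>carrier (mpoly_ring J). g \<oplus>\<^bsub>mpoly_ring J\<^esub> f = \<zero>\<^bsub>mpoly_ring J\<^esub>"
      by (intro bexI[of _ "- f"]) (auto intro: mpolys_uminus)
  qed (auto intro: mpolys_add mpolys_zero simp: ac_simps)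
  show "comm_monoid (mpoly_ring J :: ('i, 'k) mpoly ring)"
    by (rule comm_monoidI) (auto intro: mpolys_mult mpolys_one simp: ac_simps)
qed (simp add: distrib_right)

lemma mpoly_ring_a_minus:
  assumes "f \<in> mpolys J" "g \<in> mpolys J"
  shows "f \<ominus>\<^bsub>mpoly_ring J\<^esub> g = f - g"
proof -
  interpret cring "mpoly_ring J" by (rule cring_mpoly_ring)
  have "\<ominus>\<^bsub>mpoly_ring J\<^esub> g = - g"
    by (rule minus_equality) (use assms in \<open>auto intro: mpolys_uminus\<close>)
  then show ?thesis by (simp add: a_minus_def)
qed

lemma mpoly_const_add: "mpoly_const (a + b) = mpoly_const a + mpoly_const b"
  by (simp add: mpoly_const_def single_add)

lemma mpoly_const_mult: "mpoly_const (a * b) = mpoly_const a * mpoly_const b"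
  by (simp add: mpoly_const_def mult_single)

lemma mpoly_const_one [simp]: "mpoly_const 1 = 1"
  by (simp add: mpoly_const_def)

lemma mpoly_const_0 [simp]: "mpoly_const 0 = 0"
  by (simp add: mpoly_const_def)

lemma subfield_constants:
  "subfield (range mpoly_const) (mpoly_ring J :: ('i, 'k::field) mpoly ring)"
proof -
  interpret cring "mpoly_ring J :: ('i, 'k) mpoly ring" by (rule cring_mpoly_ring)
  let ?K = "range mpoly_const :: ('i, 'k) mpoly set"
  show ?thesis
  proof (rule subfieldI)
    show "subcring ?K (mpoly_ring J)"
    proof (rule subcringI', rule subringI)
      fix h :: "('i, 'k) mpoly" assume "h \<in> ?K"
      then obtain c where c: "h = mpoly_const c" by blast
      have "\<ominus>\<^bsub>mpoly_ring J\<^esub> h = mpoly_const (- c)"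
        by (rule minus_equality) (auto simp: c mpolys_const simp flip: mpoly_const_add)
      then show "\<ominus>\<^bsub>mpoly_ring J\<^esub> h \<in> ?K" by blast
    next
      show "\<one>\<^bsub>mpoly_ring J\<^esub> \<in> ?K"
        using mpoly_const_one by (metis mpoly_ring_simps(3) rangeI)
    qed (auto simp: mpolys_const simp flip: mpoly_const_add mpoly_const_mult)
    have "\<exists>g\<in>?K. g * f = 1 \<and> f * g = 1" if f: "f \<in> ?K" "f \<noteq> 0" for f :: "('i, 'k) mpoly"
    proof -
      obtain c where c: "f = mpoly_const c" "c \<noteq> 0" using f by fastforce
      then show ?thesis
        by (intro bexI[of _ "mpoly_const (inverse c)"]) (auto simp flip: mpoly_const_mult)
    qed
    then show "Units ((mpoly_ring J :: ('i, 'k) mpoly ring)\<lparr>carrier := ?K\<rparr>) =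
        ?K - {\<zero>\<^bsub>mpoly_ring J\<^esub>}"
      by (auto simp: Units_def)
  qed
qed

lemma Span_monomials:
  "ring.Span (mpoly_ring J :: ('i, 'k::field) mpoly ring) (range mpoly_const)
     (map (\<lambda>m. Poly_Mapping.single m 1) ms) = {f. Poly_Mapping.keys f \<subseteq> set ms}"
proof -
  interpret cring "mpoly_ring J :: ('i, 'k) mpoly ring" by (rule cring_mpoly_ring)
  show ?thesis
  proof (induction ms)
    case Nil
    show ?case by auto
  next
    case (Cons m ms)
    have "{f. Poly_Mapping.keys f \<subseteq> set (m # ms)} =
        {mpoly_const c * Poly_Mapping.single m 1 + g | (c :: 'k) g. Poly_Mapping.keys g \<subseteq> set ms}"
      (is "?L = ?R")
    proof
      show "?R \<subseteq> ?L"
      proof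
        fix f assume "f \<in> ?R"
        then obtain c g where f: "f = Poly_Mapping.single m c + g" "Poly_Mapping.keys g \<subseteq> set ms"
          by (auto simp: mpoly_const_def mult_single)
        have "Poly_Mapping.keys f \<subseteq> Poly_Mapping.keys (Poly_Mapping.single m c) \<union> Poly_Mapping.keys g"
          unfolding f(1) by (rule keys_add)
        also have "\<dots> \<subseteq> {m} \<union> set ms"
          using f(2) by (intro Un_mono) auto
        finally show "f \<in> ?L" by simp
      qed
      show "?L \<subseteq> ?R"
      proof
        fix f :: "('i, 'k) mpoly" assume f: "f \<in> ?L"
        define g where "g = f - Poly_Mapping.single m (Poly_Mapping.lookup f m)"
        have "Poly_Mapping.lookup g k = (if k = m then 0 else Poly_Mapping.lookup f k)" for k
          by (simp add: g_def lookup_minus lookup_single when_def)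
        then have "Poly_Mapping.keys g \<subseteq> Poly_Mapping.keys f - {m}"
          by (auto simp: in_keys_iff split: if_splits)
        then have "Poly_Mapping.keys g \<subseteq> set ms" using f by auto
        moreover have "f = mpoly_const (Poly_Mapping.lookup f m) * Poly_Mapping.single m 1 + g"
          by (simp add: g_def mpoly_const_def mult_single)
        ultimately show "f \<in> ?R" by blast
      qed
    qed
    moreover have "f \<in> Span (range mpoly_const)
        (map (\<lambda>m. Poly_Mapping.single m (1::'k)) (m # ms)) \<longleftrightarrow> f \<in> ?R" for f
      using Cons by (simp add: line_extension_mem_iff) blast
    ultimately show ?case by blast
  qed
qed

lemma dimension_monomials:
  assumes "finite M" "\<And>m. m \<in> M \<Longrightarrow> Poly_Mapping.keys m \<subseteq> J"
  shows "ring.dimension (mpoly_ring J :: ('i, 'k::field) mpoly ring) (card M) (range mpoly_const)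
     {f. Poly_Mapping.keys f \<subseteq> M}"
proof -
  interpret cring "mpoly_ring J :: ('i, 'k) mpoly ring" by (rule cring_mpoly_ring)
  let ?U = "map (\<lambda>m. Poly_Mapping.single m (1::'k))"
  have indep: "independent (range mpoly_const) (?U ms)"
    if "distinct ms" "\<And>m. m \<in> set ms \<Longrightarrow> Poly_Mapping.keys m \<subseteq> J" for ms
    using that
  proof (induction ms)
    case (Cons m ms)
    have "Poly_Mapping.single m (1::'k) \<notin> Span (range mpoly_const) (?U ms)"
      unfolding Span_monomials using Cons.prems(1) by simp
    moreover have "Poly_Mapping.single m (1::'k) \<in> carrier (mpoly_ring J)"
      using Cons.prems(2) by (simp add: mpolys_def)
    ultimately show ?case
      using Cons by (simp del: Span.simps mpoly_ring_simps add: li_Cons)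
  qed simp
  obtain ms where ms: "set ms = M" "distinct ms"
    using finite_distinct_list[OF assms(1)] by blast
  have "dimension (length (?U ms)) (range mpoly_const) {f. Poly_Mapping.keys f \<subseteq> M}"
    using subfield_constants[of J] indep[OF ms(2)] assms(2) Span_monomials[of J ms] ms(1)
    by (intro dimensionI) auto
  then show ?thesis
    using ms distinct_card[OF ms(2)] by simp
qed

lemma ideal_vanishing_ideal: "ideal (vanishing_ideal J Y) (mpoly_ring J)"
proof -
  interpret cring "mpoly_ring J" by (rule cring_mpoly_ring)
  show ?thesis
    unfolding vanishing_ideal_def
    by (rule genideal_ideal) (auto simp: homogeneous_mpolys_def mpolys_of_degree_def)
qed

lemma mem_vanishing_ideal_iff:
  assumes f: "f \<in> mpolys_of_degree J t"
  shows "f \<in> vanishing_ideal J Y \<longleftrightarrow> (\<forall>P\<in>Y. vanishes_at f P)"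
proof
  interpret cring "mpoly_ring J" by (rule cring_mpoly_ring)
  let ?G = "{f \<in> homogeneous_mpolys J. \<forall>P\<in>Y. vanishes_at f P}"
  \<comment> \<open>The polynomials that vanish on all coordinate vectors, homogeneous or not, form an ideal.\<close>
  let ?V = "{f \<in> mpolys J. \<forall>P\<in>Y. vanishes_at f P}"
  have G: "?G \<subseteq> mpolys J"
    by (auto simp: homogeneous_mpolys_def mpolys_of_degree_def)
  show "f \<in> vanishing_ideal J Y" if "\<forall>P\<in>Y. vanishes_at f P"
    unfolding vanishing_ideal_def
    using genideal_self[of ?G] G that mpolys_of_degree_homogeneous[OF f] by auto
  have "ideal ?V (mpoly_ring J)"
  proof (rule idealI)
    show "subgroup ?V (add_monoid (mpoly_ring J))"
    proof (rule add.subgroupI)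
      fix f assume f: "f \<in> ?V"
      have "\<ominus>\<^bsub>mpoly_ring J\<^esub> f = - f"
        by (rule minus_equality) (use f in \<open>auto intro: mpolys_uminus\<close>)
      moreover have "mpoly_eval (- f) v = - mpoly_eval f v" for v
        using mpoly_eval_add[of f "- f" v] by (simp add: eq_neg_iff_add_eq_0 add.commute)
      ultimately show "\<ominus>\<^bsub>mpoly_ring J\<^esub> f \<in> ?V"
        using f by (auto intro: mpolys_uminus simp: vanishes_at_def)
    qed (auto simp: vanishes_at_def mpoly_eval_add intro: mpolys_add intro!: exI[of _ 0] mpolys_zero)
  qed (auto simp: vanishes_at_def mpoly_eval_mult intro: mpolys_mult ring_axioms)
  moreover have "?G \<subseteq> ?V" using G by auto
  ultimately have "vanishing_ideal J Y \<subseteq> ?V"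
    unfolding vanishing_ideal_def by (rule genideal_minimal)
  then show "\<forall>P\<in>Y. vanishes_at f P" if "f \<in> vanishing_ideal J Y"
    using that by auto
qed

text \<open>
  Modulo the vanishing ideal, every form of degree \<open>t\<close> is congruent to exactly one combination of
  the minimal monomials of degree \<open>t\<close>, because these represent each element of the sumset exactly
  once and the class of a form is determined by its fibre coefficients. The projection to the
  coordinate ring thus maps the span of these monomials bijectively onto the graded piece.
\<close>
lemma hilbert_function_eq_card_sumset:
  fixes Y :: "((nat \<Rightarrow>\<^sub>0 nat) \<Rightarrow> 'k::field_char_0) set set"
  assumes A: "finite A" "A \<subseteq> nat_vectors n" "A \<noteq> {}"
  defines "Y \<equiv> veronese_projection n A"
  shows "hilbert_function A Y t = card (sumset t A)"
proof -
  let ?R = "mpoly_ring A :: (nat \<Rightarrow>\<^sub>0 nat, 'k) mpoly ring"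
  let ?I = "vanishing_ideal A Y"
  let ?h = "residue_class A Y"
  let ?K = "range mpoly_const :: (nat \<Rightarrow>\<^sub>0 nat, 'k) mpoly set"
  interpret R: cring ?R by (rule cring_mpoly_ring)
  interpret I: ideal ?I ?R by (rule ideal_vanishing_ideal)
  have h: "?h = (+>\<^bsub>?R\<^esub>) ?I" by (simp add: residue_class_def fun_eq_iff)
  interpret h: ring_hom_ring ?R "coord_ring A Y" ?h
    unfolding h coord_ring_def by (rule I.rcos_ring_hom_ring)
  have h_eq: "?h f = ?h g \<longleftrightarrow> (\<forall>c. fibre_coeff f c = fibre_coeff g c)"
    if "f \<in> mpolys_of_degree A s" "g \<in> mpolys_of_degree A s" for f g s
  proof -
    have fg: "f \<in> mpolys A" "g \<in> mpolys A" using that by (auto simp: mpolys_of_degree_def)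
    have "- g \<in> mpolys_of_degree A s"
      using that(2) by (simp add: mpolys_of_degree_def mpolys_def)
    from mpolys_of_degree_add[OF that(1) this]
    have diff: "f - g \<in> mpolys_of_degree A s" by simp
    have "?h f = ?h g \<longleftrightarrow> f - g \<in> ?I"
      using R.quotient_eq_iff_same_a_r_cos[OF I.ideal_axioms, of f g] fg mpoly_ring_a_minus[of f A g]
      by (simp add: residue_class_def)
    also have "\<dots> \<longleftrightarrow> (\<forall>c. fibre_coeff (f - g) c = 0)"
      unfolding mem_vanishing_ideal_iff[OF diff] Y_def
      by (rule vanishes_on_projection_iff[OF A diff])
    finally show ?thesis by (simp add: fibre_coeff_diff)
  qed
  have one_neq_zero: "\<one>\<^bsub>coord_ring A Y\<^esub> \<noteq> \<zero>\<^bsub>coord_ring A Y\<^esub>"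
  proof -
    have "fibre_coeff (1 :: (nat \<Rightarrow>\<^sub>0 nat, 'k) mpoly) 0 = 1"
      by (simp add: fibre_coeff_def cong: conj_cong flip: single_one)
    then have "?h 1 \<noteq> ?h 0"
      using h_eq[OF mpolys_of_degree_one, of 0] by (auto simp: mpolys_of_degree_def mpolys_def)
    then show ?thesis
      using h.hom_one h.hom_zero by simp
  qed
  define M where "M = {m \<in> minimal_monoms A. tdeg m = t}"
  have M: "bij_betw weighted_sum M (sumset t A)"
    unfolding M_def by (rule bij_betw_minimal_monoms[OF A(1)])
  have finM: "finite M"
    using M finite_sumset[OF A(1)] bij_betw_finite by blast
  have M_forms: "f \<in> mpolys_of_degree A t" if "Poly_Mapping.keys f \<subseteq> M"
    for f :: "(nat \<Rightarrow>\<^sub>0 nat, 'k) mpoly"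
    using that by (auto simp: M_def mpolys_of_degree_def mpolys_def minimal_monoms_def)
  have fibre_M: "fibre_coeff f (weighted_sum m) = Poly_Mapping.lookup f m"
    if f: "Poly_Mapping.keys f \<subseteq> M" "m \<in> M" for f :: "(nat \<Rightarrow>\<^sub>0 nat, 'k) mpoly" and m
  proof -
    have "{m'. m' \<in> M \<and> weighted_sum m' = weighted_sum m} = {m}"
      using M that(2) by (auto simp: bij_betw_def inj_on_def)
    then show ?thesis
      by (simp add: fibre_coeff_superset[OF finM f(1)])
  qed
  let ?E = "{f :: (nat \<Rightarrow>\<^sub>0 nat, 'k) mpoly. Poly_Mapping.keys f \<subseteq> M}"
  have "inj_on ?h ?E"
  proof (rule inj_onI)
    fix f g assume fg: "f \<in> ?E" "g \<in> ?E" "?h f = ?h g"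
    then have eq: "\<forall>c. fibre_coeff f c = fibre_coeff g c"
      using h_eq[of f t g] M_forms by simp
    have "Poly_Mapping.lookup f m = Poly_Mapping.lookup g m" for m
    proof (cases "m \<in> M")
      case True
      then show ?thesis using eq fibre_M fg by (metis mem_Collect_eq)
    next
      case False
      then have "m \<notin> Poly_Mapping.keys f" "m \<notin> Poly_Mapping.keys g" using fg by auto
      then show ?thesis by (simp add: in_keys_iff)
    qed
    then show "f = g" by (rule poly_mapping_eqI)
  qed
  moreover have "R.dimension (card M) ?K ?E"
    by (rule dimension_monomials[OF finM]) (auto simp: M_def minimal_monoms_def)
  ultimately have "h.S.dimension (card M) (?h ` ?K) (?h ` ?E)"
    by (rule h.inj_hom_dimension[OF subfield_constants one_neq_zero])
  moreover have "?h ` ?E = ?h ` mpolys_of_degree A t"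
  proof
    show "?h ` ?E \<subseteq> ?h ` mpolys_of_degree A t" using M_forms by blast
    show "?h ` mpolys_of_degree A t \<subseteq> ?h ` ?E"
    proof (rule image_subsetI)
      fix f :: "(nat \<Rightarrow>\<^sub>0 nat, 'k) mpoly"
      assume f: "f \<in> mpolys_of_degree A t"
      define g where "g = (\<Sum>m\<in>M. Poly_Mapping.single m (fibre_coeff f (weighted_sum m)))"
      have lookup_g: "Poly_Mapping.lookup g m = (if m \<in> M then fibre_coeff f (weighted_sum m) else 0)"
        for m
        using finM by (simp add: g_def lookup_sum lookup_single when_def)
      then have g: "Poly_Mapping.keys g \<subseteq> M"
        by (auto simp: in_keys_iff split: if_splits)
      have "fibre_coeff f c = fibre_coeff g c" for c
      proof (cases "c \<in> sumset t A")
        case True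
        then obtain m where "m \<in> M" "c = weighted_sum m"
          using M by (auto simp: bij_betw_def)
        then show ?thesis using fibre_M[OF g] lookup_g by simp
      qed (simp add: fibre_coeff_outside[OF f] fibre_coeff_outside[OF M_forms[OF g]])
      then have "?h f = ?h g" using h_eq[OF f M_forms[OF g]] by blast
      then show "?h f \<in> ?h ` ?E" using g by blast
    qed
  qed
  ultimately have "h.S.dimension (card M) (?h ` ?K) (?h ` mpolys_of_degree A t)" by simp
  then have "ring.dim (coord_ring A Y) (?h ` ?K) (?h ` mpolys_of_degree A t) = card M"
    using h.S.dimI[OF h.img_is_subfield(2)[OF subfield_constants one_neq_zero]]
    by (simp add: over_def)
  moreover have "card M = card (sumset t A)"
    using M by (rule bij_betw_same_card)
  ultimately show ?thesis
    by (simp add: hilbert_function_def image_image)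
qed

section \<open>The Hilbert polynomial\<close>

lemma eventually_poly_unique:
  fixes p q :: "'a::{idom, ring_char_0} poly"
  assumes "\<forall>\<^sub>F t in sequentially. poly p (of_nat t) = poly q (of_nat t)"
  shows "p = q"
proof (rule ccontr)
  assume "p \<noteq> q"
  then have "finite {x. poly (p - q) x = 0}" by (intro poly_roots_finite) simp
  moreover obtain N where "\<And>t. t \<ge> N \<Longrightarrow> poly p (of_nat t) = poly q (of_nat t)"
    using assms by (auto simp: eventually_sequentially)
  then have "of_nat ` {N..} \<subseteq> {x. poly (p - q) x = 0}" by auto
  ultimately have "finite ((of_nat :: nat \<Rightarrow> 'a) ` {N..})" by (rule rev_finite_subset)
  then have "finite {N..}" by (rule finite_imageD) (auto simp: inj_on_def)
  then show False by (simp add: infinite_Ici)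
qed

lemma hilbert_polynomial_eqI:
  assumes "\<forall>\<^sub>F t in sequentially. of_nat (hilbert_function J Y t) = poly p (of_nat t)"
  shows "hilbert_polynomial J Y = p"
  unfolding hilbert_polynomial_def
proof (rule the_equality)
  show "\<forall>\<^sub>F t in sequentially. poly p (of_nat t) = of_nat (hilbert_function J Y t)"
    using assms by eventually_elim simp
  show "q = p" if "\<forall>\<^sub>F t in sequentially. poly q (of_nat t) = of_nat (hilbert_function J Y t)" for q
    by (rule eventually_poly_unique) (use that assms in eventually_elim, simp)
qed

theorem proposition3p3:
  fixes n :: nat
    and A :: "(nat \<Rightarrow>\<^sub>0 nat) set"
    and Y :: "((nat \<Rightarrow>\<^sub>0 nat) \<Rightarrow> 'k::{alg_closed_field, field_char_0}) set set"
  defines "Y \<equiv> veronese_projection n A"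
  assumes "n \<ge> 1" and "A \<subseteq> nat_vectors n" and "finite A" and "A \<noteq> {}"
  shows "(\<forall>t. hilbert_function A Y t = cardinality_function A t) \<and>
    (\<exists>p :: rat poly. p = hilbert_polynomial A Y \<and>
       enat (degree p) = variety_dim A Y \<and> variety_dim A Y \<le> enat n \<and>
       (\<forall>\<^sub>F t in sequentially. of_nat (hilbert_function A Y t) = poly p (of_nat t)))"
proof -
  note A = assms(4,3,5)
  have HF: "hilbert_function A Y t = card (sumset t A)" for t
    unfolding Y_def by (rule hilbert_function_eq_card_sumset[OF A])
  obtain p :: "rat poly"
    where p: "\<forall>\<^sub>F t in sequentially. of_nat (card (sumset t A)) = poly p (of_nat t)"
    using eventually_polynomial_card_sumset[OF A(1)] by (auto simp: eventually_polynomial_def)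
  \<comment> \<open>Degree, number of pivots and dimension are compared in a circle of inequalities.\<close>
  have "degree p \<le> card (pivots A)"
    by (rule degree_le_if_card_bounded[OF p card_sumset_le[OF A(1,2)]])
  then have "enat (degree p) \<le> enat (card (pivots A))" by simp
  also have ge: "\<dots> \<le> variety_dim A Y"
    unfolding Y_def by (rule card_pivots_le_dim[OF A])
  finally have "enat (degree p) \<le> variety_dim A Y" .
  moreover have le: "variety_dim A Y \<le> enat (degree p)"
    unfolding Y_def by (rule dim_le_degree[OF A p])
  ultimately have dim: "enat (degree p) = variety_dim A Y" by (rule antisym)
  have "card (pivots A) \<le> n"
    using card_mono[OF _ pivots_subset[OF A(2)]] by simp
  then have "variety_dim A Y \<le> enat n"
    using le \<open>degree p \<le> card (pivots A)\<close> by (meson enat_ord_simps(1) order_trans)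
  moreover have "p = hilbert_polynomial A Y"
    using hilbert_polynomial_eqI[of A Y p] p by (simp add: HF)
  ultimately show ?thesis
    using dim p by (auto simp: HF cardinality_function_def)
qed

end
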